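(* Let $R$ be a finite commutative ring with unity given by a ring oracle, and let $R\cong R_1\oplus\cdots\oplus R_\ell$ be its decomposition into local rings, where $R_i$ has characteristic $p_i^{\alpha_i}$ ($p_i$ prime). Let $f\in R[x_1,\ldots,x_n]$ of degree at most $d$ be given via black-box access, and let $\epsilon>0$ be a given constant. If $p_i\ge knd$ for all $i$, for some integer $k\ge 2$, then there is a randomized polynomial-time identity test for $f$ (deciding whether $f\equiv 0$) with success probability at least $1-\frac{1}{k}\left(1+\frac{\epsilon}{2}\right)$.
   Context: A ring oracle for $R$: the elements of $R$ are uniformly encoded as strings in $\{0,1\}^m$, with designated strings encoding $0$ and $1$, and ring addition, multiplication (and negation) are performed by queries to the oracle. Every finite commutative ring with unity is isomorphic to a direct sum of local rings (rings with a unique maximal ideal). Black-box access to $f$ means one can query the value $f(a_1,\ldots,a_n)\in R$ for any $a_1,\ldots,a_n\in R$. The input size is polynomial in $n$, $d$ and $m$. *)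

theory Defs
  imports
    "HOL-Algebra.Multiplicative_Group"
    "HOL-Algebra.Chinese_Remainder"
    "HOL-Algebra.Indexed_Polynomials"
    "HOL-Probability.Probability_Mass_Function"
begin

section \<open>Local rings and characteristic\<close>

definition local_ring :: "('a, 'b) ring_scheme \<Rightarrow> bool" where
  "local_ring R \<longleftrightarrow> cring R \<and> (\<exists>!I. maximalideal I R)"

definition ring_char :: "('a, 'b) ring_scheme \<Rightarrow> nat" where
  "ring_char R = group.ord (add_monoid R) \<one>\<^bsub>R\<^esub>"


section \<open>Polynomials in n variables\<close>

text \<open>
  A polynomial maps each monomial, a multiset of variable indices, to its coefficient.
\<close>

definition mpolys :: "('a, 'b) ring_scheme \<Rightarrow> nat \<Rightarrow> (nat multiset \<Rightarrow> 'a) set" where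
  "mpolys R n = ring.indexed_pset R {..<n} (carrier R)"

definition zero_mpoly :: "('a, 'b) ring_scheme \<Rightarrow> nat multiset \<Rightarrow> 'a" where
  "zero_mpoly R = ring.indexed_const R \<zero>\<^bsub>R\<^esub>"

definition total_degree_le :: "('a, 'b) ring_scheme \<Rightarrow> (nat multiset \<Rightarrow> 'a) \<Rightarrow> nat \<Rightarrow> bool" where
  "total_degree_le R f d \<longleftrightarrow> (\<forall>M. f M \<noteq> \<zero>\<^bsub>R\<^esub> \<longrightarrow> size M \<le> d)"

definition mpoly_eval :: "('a, 'b) ring_scheme \<Rightarrow> (nat multiset \<Rightarrow> 'a) \<Rightarrow> 'a list \<Rightarrow> 'a" where
  "mpoly_eval R f xs =
     finsum R
       (\<lambda>M. f M \<otimes>\<^bsub>R\<^esub> finprod R (\<lambda>i. (xs ! i) [^]\<^bsub>R\<^esub> count M i) (set_mset M))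
       {M. f M \<noteq> \<zero>\<^bsub>R\<^esub>}"


section \<open>Randomized programs with oracles\<close>

text \<open>
  The machine model is a randomized multi-stack machine with oracles, given by structured
  programs. A program is a finite piece of syntax and so mentions only finitely many registers.
  Each register holds a stack of bits (list head on top). One step handles a single bit, tosses
  a single coin or makes a single call to one of the oracles, so that the number of steps agrees,
  up to a polynomial, with the running time of a randomized multi-tape Turing machine with
  oracles (two stacks simulate a tape, and conversely). A call replaces the query string in a
  register by the answer; query strings have to be written, and answers read, bit by bit.
\<close>

datatype query = RingAdd | RingMult | RingNeg | EvalPoly

type_synonym oracles = "query \<Rightarrow> bool list \<Rightarrow> bool list"

type_synonym store = "nat \<Rightarrow> bool list"

text \<open>
  In \<open>Branch r A B C\<close> the branch \<open>A\<close> is for an empty register \<open>r\<close>, and \<open>B\<close> and \<open>C\<close> are for top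
  bit \<open>True\<close> and \<open>False\<close>. \<open>While r A\<close> repeats \<open>A\<close> as long as register \<open>r\<close> is not empty.
\<close>

datatype instr =
    Push nat bool
  | Pop nat
  | Flip nat
  | Call query nat
  | Branch nat "instr list" "instr list" "instr list"
  | While nat "instr list"

type_synonym program = "instr list"

type_synonym config = "program \<times> store"

fun step :: "oracles \<Rightarrow> config \<Rightarrow> config pmf" where
  "step orc ([], s) = return_pmf ([], s)"
| "step orc (Push r b # P, s) = return_pmf (P, s(r := b # s r))"
| "step orc (Pop r # P, s) = return_pmf (P, s(r := tl (s r)))"
| "step orc (Flip r # P, s) = map_pmf (\<lambda>b. (P, s(r := b # s r))) (bernoulli_pmf (1 / 2))"
| "step orc (Call q r # P, s) = return_pmf (P, s(r := orc q (s r)))"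
| "step orc (Branch r A B C # P, s) =
     return_pmf ((case s r of [] \<Rightarrow> A | b # _ \<Rightarrow> if b then B else C) @ P, s)"
| "step orc (While r A # P, s) = return_pmf (if s r = [] then P else A @ While r A # P, s)"

primrec run :: "oracles \<Rightarrow> nat \<Rightarrow> config \<Rightarrow> config pmf" where
  "run orc 0 c = return_pmf c"
| "run orc (Suc t) c = bind_pmf (step orc c) (run orc t)"

text \<open>The program is finished on every sequence of coin tosses after at most \<open>t\<close> steps.\<close>

definition halts_within :: "oracles \<Rightarrow> nat \<Rightarrow> program \<Rightarrow> store \<Rightarrow> bool" where
  "halts_within orc t P s \<longleftrightarrow> (\<forall>(Q, s') \<in> set_pmf (run orc t (P, s)). Q = [])"

text \<open>
  The answer of a finished run is read off register \<open>0\<close>. Finished configurations do not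
  change any more, so that the number \<open>t\<close> of steps only has to be large enough.
\<close>

definition answer_prob :: "oracles \<Rightarrow> nat \<Rightarrow> program \<Rightarrow> store \<Rightarrow> bool \<Rightarrow> real" where
  "answer_prob orc t P s b =
     measure_pmf.prob (run orc t (P, s)) {(Q, s'). Q = [] \<and> s' 0 = [b]}"


section \<open>Identity testing in the black-box model\<close>

text \<open>
  The ring elements are themselves the strings encoding them. Any finite ring with an injective
  encoding of its elements by \<open>m\<close>-bit strings can be transported to such a ring, and because the
  carrier type does not depend on the ring, one program can be required to work for all rings.
  Not every \<open>m\<close>-bit string need encode an element; the oracles are unconstrained on queries
  that do not consist of encodings.
\<close>

definition bit_string_ring :: "nat \<Rightarrow> bool list ring \<Rightarrow> bool" where
  "bit_string_ring m R \<longleftrightarrow> cring R \<and> carrier R \<subseteq> {x. length x = m}"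

definition ring_oracle :: "bool list ring \<Rightarrow> oracles \<Rightarrow> bool" where
  "ring_oracle R orc \<longleftrightarrow>
     (\<forall>x \<in> carrier R. \<forall>y \<in> carrier R.
        orc RingAdd (x @ y) = x \<oplus>\<^bsub>R\<^esub> y \<and>
        orc RingMult (x @ y) = x \<otimes>\<^bsub>R\<^esub> y \<and>
        orc RingNeg x = \<ominus>\<^bsub>R\<^esub> x)"

definition black_box :: "bool list ring \<Rightarrow> nat \<Rightarrow> (nat multiset \<Rightarrow> bool list) \<Rightarrow> oracles \<Rightarrow> bool" where
  "black_box R n f orc \<longleftrightarrow>
     (\<forall>xs. length xs = n \<and> set xs \<subseteq> carrier R \<longrightarrow>
        orc EvalPoly (concat xs) = mpoly_eval R f xs)"

text \<open>The sizes are given in unary, together with the strings encoding zero and one.\<close>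

definition pit_input :: "nat \<Rightarrow> nat \<Rightarrow> nat \<Rightarrow> bool list ring \<Rightarrow> store" where
  "pit_input n d m R =
     (\<lambda>_. [])(0 := replicate n True, 1 := replicate d True, 2 := replicate m True,
              3 := \<zero>\<^bsub>R\<^esub>, 4 := \<one>\<^bsub>R\<^esub>)"

end

theory Submission
  imports Defs "HOL-Number_Theory.Cong" "HOL-Computational_Algebra.Polynomial"
begin

text \<open>
  The test evaluates \<open>f\<close> at a point \<open>(a\<^sub>1 \<cdot> 1, \<dots>, a\<^sub>n \<cdot> 1)\<close>, where the integers \<open>a\<^sub>i\<close> are uniform in
  \<open>{0..<2\<^sup>m\<^sup>+\<^sup>e}\<close> with \<open>2\<^sup>-\<^sup>e < \<epsilon> / 2\<close> and their images in the ring are computed by double-and-add,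
  and compares the value with zero.

  Let \<open>f \<noteq> 0\<close>. Some integer multiple \<open>t f\<close> is nonzero and killed by a prime \<open>p\<close>, which is one of the
  \<open>p\<^sub>i\<close> since the product of the \<open>p\<^sub>i\<close> to the \<open>\<alpha>\<^sub>i\<close> annihilates the ring. An additive functional from
  the \<open>p\<close>-torsion to the integers modulo \<open>p\<close> that does not vanish on some coefficient of \<open>t f\<close> turns
  \<open>t f\<close> into a nonzero polynomial over a prime field, evaluated at the integers \<open>a\<^sub>i\<close>. As
  \<open>p \<le> 2\<^sup>m\<close>, each \<open>a\<^sub>i\<close> hits a given residue class modulo \<open>p\<close> with probability at most
  \<open>\<delta> = (1 + \<epsilon> / 2) / p\<close>, so fixing the variables one at a time, each of degree at most \<open>d\<close>, loses at
  most \<open>n d \<delta>\<close>, which is at most \<open>(1 + \<epsilon> / 2) / k\<close>.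
\<close>

section \<open>Oblivious execution of programs\<close>

lemma run_add: "run orc (a + b) c = bind_pmf (run orc a c) (run orc b)"
  by (induction a arbitrary: c) (auto simp: bind_return_pmf bind_assoc_pmf intro: bind_pmf_cong)

lemma run_finished [simp]: "run orc t ([], s) = return_pmf ([], s)"
  by (induction t) (simp_all add: bind_return_pmf)

text \<open>
  The number of steps is required to be exactly \<open>t\<close>, whatever the coin tosses. All programs below
  are written so that this holds (for instance, a zero is added where a one might have been), which
  makes the composition rules independent of the outcomes.
\<close>

definition exec :: "oracles \<Rightarrow> nat \<Rightarrow> program \<Rightarrow> store \<Rightarrow> store pmf \<Rightarrow> bool" where
  "exec orc t P s D \<longleftrightarrow> (\<forall>Q. run orc t (P @ Q, s) = map_pmf (Pair Q) D)"

lemma exec_Nil: "exec orc 0 [] s (return_pmf s)"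
  by (simp add: exec_def)

text \<open>The outcome is written as \<open>map_pmf h M\<close>, so the continuation may depend on
  the sampled value \<open>x\<close> itself instead of having to recover it from the store. The
  arbitrary continuation inside \<open>exec\<close> is instantiated with \<open>Q\<close> followed
  by the rest of the program.\<close>

lemma exec_append_bind:
  assumes "exec orc t P s (map_pmf h M)" "\<And>x. x \<in> set_pmf M \<Longrightarrow> exec orc u Q (h x) (E x)"
  shows "exec orc (t + u) (P @ Q) s (bind_pmf M E)"
proof -
  have "bind_pmf M (\<lambda>x. run orc u (Q @ Q', h x)) = bind_pmf M (\<lambda>x. map_pmf (Pair Q') (E x))" for Q'
    using assms(2) by (intro bind_pmf_cong) (auto simp: exec_def)
  then show ?thesis
    using assms(1) by (simp add: exec_def run_add bind_map_pmf map_bind_pmf)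
qed

lemma exec_append:
  assumes "exec orc t P s (return_pmf s')" "exec orc u Q s' D" "w = t + u"
  shows "exec orc w (P @ Q) s D"
  using exec_append_bind[of orc t P s id "return_pmf s'" u Q "\<lambda>_. D"] assms by (simp add: bind_return_pmf)

lemma exec_Push: "exec orc t P (s(r := b # s r)) D \<Longrightarrow> exec orc (Suc t) (Push r b # P) s D"
  by (simp add: exec_def bind_return_pmf)

lemma exec_Pop: "exec orc t P (s(r := tl (s r))) D \<Longrightarrow> exec orc (Suc t) (Pop r # P) s D"
  by (simp add: exec_def bind_return_pmf)

lemma exec_Call: "exec orc t P (s(r := orc q (s r))) D \<Longrightarrow> exec orc (Suc t) (Call q r # P) s D"
  by (simp add: exec_def bind_return_pmf)

lemma exec_Flip:
  assumes "\<And>b. exec orc t P (s(r := b # s r)) (D b)"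
  shows "exec orc (Suc t) (Flip r # P) s (bind_pmf (bernoulli_pmf (1 / 2)) D)"
  using assms by (simp add: exec_def bind_map_pmf map_bind_pmf)

lemma exec_Branch:
  "exec orc t ((case s r of [] \<Rightarrow> A | b # _ \<Rightarrow> if b then B else C) @ P) s D \<Longrightarrow>
    exec orc (Suc t) (Branch r A B C # P) s D"
  by (simp add: exec_def bind_return_pmf)

lemma exec_While_Nil: "s r = [] \<Longrightarrow> exec orc t P s D \<Longrightarrow> exec orc (Suc t) (While r A # P) s D"
  by (simp add: exec_def bind_return_pmf)

lemma exec_While_Cons:
  "s r \<noteq> [] \<Longrightarrow> exec orc t (A @ While r A # P) s D \<Longrightarrow> exec orc (Suc t) (While r A # P) s D"
  by (simp add: exec_def bind_return_pmf)

section \<open>Subroutines that move and copy stacks, with exact step counts\<close>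

definition move :: "nat \<Rightarrow> nat \<Rightarrow> program" where
  "move A B = [While A [Branch A [] [Pop A, Push B True] [Pop A, Push B False]]]"

text \<open>Each bit costs four steps (loop test, branch, pop, push), and the failing loop test
  costs one more. The order of the bits is reversed, as always when one stack is poured onto
  another.\<close>

lemma exec_move:
  assumes "A \<noteq> B"
  shows "exec orc (4 * length (s A) + 1) (move A B) s (return_pmf (s(A := [], B := rev (s A) @ s B)))"
proof (induction "s A" arbitrary: s)
  case Nil
  then have "s(A := [], B := rev (s A) @ s B) = s" by (auto simp: fun_eq_iff)
  with exec_While_Nil[of s A, OF _ exec_Nil] Nil show ?case by (simp add: move_def del: fun_upd_apply)
next
  case (Cons b w)
  let ?s = "s(A := w, B := b # s B)"
  have s: "s A = b # w" using Cons(2) by simp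
  have "w = ?s A" using assms by simp
  note IH = Cons(1)[of ?s, OF this]
  have r: "?s(A := [], B := rev (?s A) @ ?s B) = s(A := [], B := rev (s A) @ s B)"
    using assms s by (auto simp: fun_eq_iff)
  have "exec orc (Suc (Suc (Suc (Suc (4 * length w + 1))))) (move A B) s
    (return_pmf (s(A := [], B := rev (s A) @ s B)))"
    unfolding move_def
    apply (rule exec_While_Cons)
     apply (simp add: s)
    apply (simp only: append.simps)
    apply (rule exec_Branch)
    using IH assms unfolding r
    by (cases b) (auto simp: s move_def intro!: exec_Pop exec_Push)
  moreover have "Suc (Suc (Suc (Suc (4 * length w + 1)))) = 4 * length (s A) + 1" by (simp add: s)
  ultimately show ?case by (simp only:)
qed

definition move2 :: "nat \<Rightarrow> nat \<Rightarrow> nat \<Rightarrow> program" where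
  "move2 A B C = [While A [Branch A [] [Pop A, Push B True, Push C True]
     [Pop A, Push B False, Push C False]]]"

lemma exec_move2:
  assumes "A \<noteq> B" "A \<noteq> C" "B \<noteq> C"
  shows "exec orc (5 * length (s A) + 1) (move2 A B C) s
    (return_pmf (s(A := [], B := rev (s A) @ s B, C := rev (s A) @ s C)))"
proof (induction "s A" arbitrary: s)
  case Nil
  then have "s(A := [], B := rev (s A) @ s B, C := rev (s A) @ s C) = s" by (auto simp: fun_eq_iff)
  with exec_While_Nil[of s A, OF _ exec_Nil] Nil show ?case by (simp add: move2_def del: fun_upd_apply)
next
  case (Cons b w)
  let ?s = "s(A := w, B := b # s B, C := b # s C)"
  have s: "s A = b # w" using Cons(2) by simp
  have "w = ?s A" using assms by simp
  note IH = Cons(1)[of ?s, OF this]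
  have r: "?s(A := [], B := rev (?s A) @ ?s B, C := rev (?s A) @ ?s C)
      = s(A := [], B := rev (s A) @ s B, C := rev (s A) @ s C)"
    using assms s by (auto simp: fun_eq_iff)
  have "exec orc (Suc (Suc (Suc (Suc (Suc (5 * length w + 1)))))) (move2 A B C) s
    (return_pmf (s(A := [], B := rev (s A) @ s B, C := rev (s A) @ s C)))"
    unfolding move2_def
    apply (rule exec_While_Cons)
     apply (simp add: s)
    apply (simp only: append.simps)
    apply (rule exec_Branch)
    using IH assms unfolding r
    by (cases b) (auto simp: s move2_def intro!: exec_Pop exec_Push)
  moreover have "Suc (Suc (Suc (Suc (Suc (5 * length w + 1))))) = 5 * length (s A) + 1" by (simp add: s)
  ultimately show ?case by (simp only:)
qed

text \<open>Passing through the scratch register 7 reverses the string twice, so both the restored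
  source and the copy have the original bit order.\<close>

definition copy :: "nat \<Rightarrow> nat \<Rightarrow> program" where
  "copy A B = move A 7 @ move2 7 A B"

lemma exec_copy:
  assumes "A \<noteq> B" "A \<noteq> 7" "B \<noteq> 7" "s 7 = []"
  shows "exec orc (9 * length (s A) + 2) (copy A B) s (return_pmf (s(B := s A @ s B)))"
proof -
  let ?s = "s(A := [], 7 := rev (s A) @ s 7)"
  have r: "?s(7 := [], A := rev (?s 7) @ ?s A, B := rev (?s 7) @ ?s B) = s(B := s A @ s B)"
    using assms by (auto simp: fun_eq_iff)
  show ?thesis unfolding copy_def
    by (rule exec_append[OF exec_move exec_move2[of 7 A B _ ?s, unfolded r]]) (use assms in auto)
qed

definition prepend :: "nat \<Rightarrow> nat \<Rightarrow> program" where
  "prepend A B = move A 7 @ move 7 B"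

lemma exec_prepend:
  assumes "A \<noteq> B" "A \<noteq> 7" "B \<noteq> 7" "s 7 = []"
  shows "exec orc (8 * length (s A) + 2) (prepend A B) s (return_pmf (s(A := [], B := s A @ s B)))"
proof -
  let ?s = "s(A := [], 7 := rev (s A) @ s 7)"
  have r: "?s(7 := [], B := rev (?s 7) @ ?s B) = s(A := [], B := s A @ s B)"
    using assms by (auto simp: fun_eq_iff)
  show ?thesis unfolding prepend_def
    by (rule exec_append[OF exec_move exec_move[of 7 B _ ?s, unfolded r]]) (use assms in auto)
qed

section \<open>Polynomials modulo a prime at random integers\<close>

text \<open>Lagrange's bound on roots modulo a prime, phrased over the integers so that no field of
  residues has to be constructed. A root \<open>r\<close> is split off by synthetic division; the
  remainder is divisible by \<open>p\<close>, and any other root modulo \<open>p\<close> is a root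
  of the quotient because \<open>p\<close> is prime.\<close>

lemma card_roots_mod_prime_le:
  fixes q :: "int poly"
  assumes "prime p" "\<not> [:int p:] dvd q"
  shows "card {x \<in> {..<p}. int p dvd poly q (int x)} \<le> degree q"
  using assms(2)
proof (induction "degree q" arbitrary: q)
  case 0
  then obtain c where q: "q = [:c:]" by (metis degree_eq_zeroE)
  with 0 show ?case by simp
next
  case (Suc n)
  let ?Z = "\<lambda>q. {x \<in> {..<p}. int p dvd poly q (int x)}"
  show ?case
  proof (cases "?Z q = {}")
    case False
    then obtain r where r: "r < p" "int p dvd poly q (int r)" by auto
    define h where "h = synthetic_div q (int r)"
    have q: "q = [:- int r, 1:] * h + [:poly q (int r):]"
      using synthetic_div_correct'[of "int r" q] unfolding h_def by simp
    \<comment> \<open>The remainder \<open>poly q (int r)\<close> is a multiple of \<open>p\<close>,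
      so if \<open>p\<close> divided \<open>h\<close>, it would divide \<open>q\<close> as
      well.\<close>
    have "\<not> [:int p:] dvd h"
    proof
      assume "[:int p:] dvd h"
      moreover have "[:int p:] dvd [:poly q (int r):]"
        using r(2) by (auto simp: const_poly_dvd_iff coeff_pCons split: nat.splits)
      ultimately have "[:int p:] dvd q"
        by (subst q) (rule dvd_add[OF dvd_mult])
      then show False using Suc.prems by simp
    qed
    moreover have deg: "degree h = n"
      using Suc(2) by (simp add: h_def degree_synthetic_div)
    ultimately have card: "card (?Z h) \<le> n" using Suc(1) by blast
    have "?Z q \<subseteq> insert r (?Z h)"
    proof
      fix x assume "x \<in> ?Z q"
      then have x: "x < p" "int p dvd poly q (int x)" by auto
      show "x \<in> insert r (?Z h)"
      proof (cases "int p dvd poly h (int x)")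
        case False
        have "poly q (int x) = (int x - int r) * poly h (int x) + poly q (int r)"
          by (subst q) (simp add: algebra_simps)
        with x(2) r(2) have "int p dvd (int x - int r) * poly h (int x)"
          by (metis dvd_add_left_iff)
        with False assms(1) have "int p dvd int x - int r"
          by (metis prime_dvd_mult_iff prime_nat_int_transfer)
        then have "[int x = int r] (mod int p)" by (simp add: cong_iff_dvd_diff)
        then show ?thesis using x r(1) by (simp add: cong_int_iff cong_less_modulus_unique_nat)
      qed (use x in simp)
    qed
    then have "card (?Z q) \<le> card (insert r (?Z h))" by (intro card_mono) auto
    also have "\<dots> \<le> Suc (card (?Z h))" by (rule card_insert_le_m1) auto
    finally show ?thesis using card Suc(2) by simp
  next
    case True
    then show ?thesis by (simp only: card.empty)
  qed
qed

text \<open>A union bound over two stages: on the bad event \<open>B\<close> the second stage is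
  bounded trivially by 1, outside of \<open>B\<close> by \<open>v\<close>.\<close>

lemma prob_bind_pmf_le:
  assumes "measure_pmf.prob M B \<le> u" "\<And>x. x \<in> set_pmf M \<Longrightarrow> x \<notin> B \<Longrightarrow> measure_pmf.prob (N x) A \<le> v" "0 \<le> v"
  shows "measure_pmf.prob (bind_pmf M N) A \<le> u + v"
proof -
  have "emeasure (bind_pmf M N) A = (\<integral>\<^sup>+x. emeasure (N x) A \<partial>M)" by simp
  also have "\<dots> \<le> (\<integral>\<^sup>+x. indicator B x + ennreal v \<partial>M)"
  proof (intro nn_integral_mono_AE AE_pmfI)
    fix x assume "x \<in> set_pmf M"
    with assms(2,3) show "emeasure (N x) A \<le> indicator B x + ennreal v"
      by (cases "x \<in> B")
        (auto simp: measure_pmf.emeasure_eq_measure intro: order_trans[OF ennreal_leI[OF measure_pmf.prob_le_1]] ennreal_leI)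
  qed
  also have "\<dots> = emeasure M B + ennreal v"
    by (simp add: nn_integral_add)
  also have "\<dots> = ennreal (measure_pmf.prob M B + v)"
    using assms(3) by (simp add: measure_pmf.emeasure_eq_measure)
  finally have "ennreal (measure_pmf.prob (bind_pmf M N) A) \<le> ennreal (measure_pmf.prob M B + v)"
    by (simp only: measure_pmf.emeasure_eq_measure)
  then have "measure_pmf.prob (bind_pmf M N) A \<le> measure_pmf.prob M B + v"
    by (subst (asm) ennreal_le_iff) (use assms(3) in auto)
  with assms(1) show ?thesis by simp
qed

primrec iid_list :: "nat \<Rightarrow> 'a pmf \<Rightarrow> 'a list pmf" where
  "iid_list 0 D = return_pmf []"
| "iid_list (Suc n) D = bind_pmf (iid_list n D) (\<lambda>xs. map_pmf (\<lambda>x. x # xs) D)"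

text \<open>The sampling loop puts each new element in front of the query string, so the element
  drawn first ends up last. This form of the recursion matches that order.\<close>

lemma iid_list_Suc_snoc:
  "iid_list (Suc n) D = bind_pmf D (\<lambda>x. map_pmf (\<lambda>xs. xs @ [x]) (iid_list n D))"
proof (induction n)
  case 0
  then show ?case by (simp add: bind_return_pmf map_pmf_def)
next
  case (Suc n)
  show ?case
    by (subst iid_list.simps(2), subst Suc)
      (simp add: bind_assoc_pmf bind_map_pmf map_bind_pmf pmf.map_comp o_def)
qed

lemma length_iid_list: "xs \<in> set_pmf (iid_list n D) \<Longrightarrow> length xs = n"
  by (induction n arbitrary: xs) auto

text \<open>A Schwartz-Zippel bound by induction on the number of variables, with the degree bounded
  in each variable separately. The samples need not be uniform modulo \<open>p\<close>: only the
  largest probability \<delta> of a residue class enters. The separation hypothesis prevents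
  distinct indices in \<open>S\<close> from naming the same monomial and cancelling.\<close>

lemma prob_poly_mod_prime_eq_0_le:
  fixes F :: "'i \<Rightarrow> int" and e :: "'i \<Rightarrow> nat \<Rightarrow> nat" and D :: "nat pmf"
  assumes "prime p" "finite S" "M0 \<in> S" "\<not> int p dvd F M0"
    and "\<And>M M'. M \<in> S \<Longrightarrow> M' \<in> S \<Longrightarrow> (\<forall>i<n. e M i = e M' i) \<Longrightarrow> M = M'"
    and "\<And>M i. M \<in> S \<Longrightarrow> e M i \<le> d"
    and \<delta>: "\<And>c. measure_pmf.prob D {x. x mod p = c} \<le> \<delta>"
  shows "measure_pmf.prob (iid_list n D)
    {xs. int p dvd (\<Sum>M\<in>S. F M * (\<Prod>i<n. int (xs ! i) ^ e M i))} \<le> real n * real d * \<delta>"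
  using assms(2-6)
proof (induction n arbitrary: S M0 e)
  case 0
  then have "S = {M0}" by auto
  with 0 show ?case by simp
next
  case (Suc n)
  have \<delta>0: "0 \<le> \<delta>" using \<delta>[of 0] measure_nonneg order_trans by blast
  \<comment> \<open>The exponent of the first variable in \<open>M0\<close>, so that
    \<open>M0\<close> survives in the slice \<open>G j0\<close>, and the induction hypothesis
    applies to this coefficient.\<close>
  define j0 where "j0 = e M0 0"
  define G where "G = (\<lambda>j xs. \<Sum>M\<in>{M\<in>S. e M 0 = j}. F M * (\<Prod>i<n. int (xs ! i) ^ e M (Suc i)))"
  have inj: "M = M'"
    if "M \<in> {M \<in> S. e M 0 = j0}" "M' \<in> {M \<in> S. e M 0 = j0}" "\<forall>i<n. e M (Suc i) = e M' (Suc i)" for M M'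
  proof -
    have "\<forall>i<Suc n. e M i = e M' i"
      using that by (auto simp: less_Suc_eq_0_disj)
    with that show ?thesis using Suc.prems(4)[of M M'] by simp
  qed
  have IH: "measure_pmf.prob (iid_list n D) {xs. int p dvd G j0 xs} \<le> real n * real d * \<delta>"
    unfolding G_def
    by (rule Suc.IH[where e = "\<lambda>M i. e M (Suc i)" and S = "{M \<in> S. e M 0 = j0}" and ?M0.0 = M0])
      (use Suc.prems inj in \<open>auto simp: j0_def\<close>)
  let ?A = "{xs. int p dvd (\<Sum>M\<in>S. F M * (\<Prod>i<Suc n. int (xs ! i) ^ e M i))}"
  have "measure_pmf.prob (map_pmf (\<lambda>x. x # xs) D) ?A \<le> real d * \<delta>"
    if "\<not> int p dvd G j0 xs" for xs
  proof -
    define q where "q = (\<Sum>j\<le>d. monom (G j xs) j)"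
    have coeff: "coeff q j = (if j \<le> d then G j xs else 0)" for j
      by (simp add: q_def coeff_sum)
    \<comment> \<open>Coefficient \<open>j0\<close> is the witness; it lies within the summation
      range because \<open>e M0 0\<close> is at most \<open>d\<close>.\<close>
    have "\<not> [:int p:] dvd q"
      using that Suc.prems(2,5) coeff[of j0] unfolding const_poly_dvd_iff by (metis j0_def)
    moreover have "degree q \<le> d" by (rule degree_le) (simp add: coeff)
    ultimately have card: "card {x \<in> {..<p}. int p dvd poly q (int x)} \<le> d" (is "card ?Z \<le> d")
      using card_roots_mod_prime_le[OF assms(1)] order_trans by blast
    have q_eq: "(\<Sum>M\<in>S. F M * (\<Prod>i<Suc n. int ((x # xs) ! i) ^ e M i)) = poly q (int x)" for x
    proof -
      have "(\<Sum>M\<in>S. F M * (\<Prod>i<Suc n. int ((x # xs) ! i) ^ e M i))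
          = (\<Sum>M\<in>S. int x ^ e M 0 * (F M * (\<Prod>i<n. int (xs ! i) ^ e M (Suc i))))"
        by (simp add: prod.lessThan_Suc_shift mult_ac del: prod.lessThan_Suc)
      also have "\<dots> = (\<Sum>j\<le>d. \<Sum>M\<in>{M\<in>S. e M 0 = j}. int x ^ e M 0 * (F M * (\<Prod>i<n. int (xs ! i) ^ e M (Suc i))))"
        by (rule sum.group[symmetric]) (use Suc.prems in auto)
      also have "\<dots> = (\<Sum>j\<le>d. int x ^ j * G j xs)"
        unfolding G_def by (simp add: sum_distrib_left)
      also have "\<dots> = poly q (int x)"
        by (simp add: q_def poly_sum poly_monom mult.commute)
      finally show ?thesis .
    qed
    \<comment> \<open>The difference of two arguments divides the difference of the values, so being
      a root modulo \<open>p\<close> depends only on the residue of the argument.\<close>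
    have "poly q (int x) mod int p = poly q (int (x mod p)) mod int p" for x
    proof -
      have "int x - int (x mod p) dvd poly q (int x) - poly q (int (x mod p))"
        using arg_cong[OF synthetic_div_correct'[of "int (x mod p)" q], of "\<lambda>q. poly q (int x)"]
        by (intro dvdI[where k = "poly (synthetic_div q (int (x mod p))) (int x)"]) (simp add: algebra_simps)
      moreover have "int p dvd int x - int (x mod p)" by (simp add: of_nat_mod)
      ultimately show ?thesis by (meson dvd_trans mod_eq_dvd_iff)
    qed
    then have dvd_mod: "int p dvd poly q (int x) \<longleftrightarrow> int p dvd poly q (int (x mod p))" for x
      by (simp add: dvd_eq_mod_eq_0)
    have "measure_pmf.prob (map_pmf (\<lambda>x. x # xs) D) ?A = measure_pmf.prob D {x. int p dvd poly q (int x)}"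
      using q_eq by (simp add: vimage_def)
    also have "\<dots> \<le> measure_pmf.prob D (\<Union>c\<in>?Z. {x. x mod p = c})"
      using dvd_mod prime_gt_0_nat[OF assms(1)] by (intro measure_pmf.finite_measure_mono) auto
    also have "\<dots> \<le> (\<Sum>c\<in>?Z. measure_pmf.prob D {x. x mod p = c})"
      by (rule measure_pmf.finite_measure_subadditive_finite) auto
    also have "\<dots> \<le> card ?Z * \<delta>"
      using \<delta> by (intro sum_bounded_above) auto
    also have "\<dots> \<le> real d * \<delta>" using card \<delta>0 by (intro mult_right_mono) auto
    finally show ?thesis .
  qed
  then have "measure_pmf.prob (iid_list (Suc n) D) ?A \<le> real n * real d * \<delta> + real d * \<delta>"
    using IH \<delta>0 by (simp only: iid_list.simps, intro prob_bind_pmf_le[where B = "{xs. int p dvd G j0 xs}"]) auto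
  then show ?case by (simp add: algebra_simps)
qed

section \<open>Random integers generated bit by bit, and their residues\<close>

primrec random_extension :: "nat \<Rightarrow> nat \<Rightarrow> nat pmf" where
  "random_extension 0 a = return_pmf a"
| "random_extension (Suc l) a =
     bind_pmf (bernoulli_pmf (1 / 2)) (\<lambda>b. random_extension l (2 * a + of_bool b))"

text \<open>The result is uniform on the block of integers whose binary expansion is that of
  \<open>a\<close> followed by \<open>l\<close> further bits; the first coin selects the lower or
  upper half of the block.\<close>

lemma prob_random_extension:
  "measure_pmf.prob (random_extension l a) A = card (A \<inter> {a * 2 ^ l..<(a + 1) * 2 ^ l}) / 2 ^ l"
proof (induction l arbitrary: a)
  case 0
  then show ?case by (simp add: indicator_def)
next
  case (Suc l)
  let ?P = "\<lambda>b. measure_pmf.prob (random_extension l (2 * a + b)) A"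
  have "emeasure (random_extension (Suc l) a) A = ennreal (?P 1) * ennreal (1 / 2) + ennreal (?P 0) * ennreal (1 / 2)"
    by (subst random_extension.simps, subst emeasure_bind_pmf, subst nn_integral_bernoulli_pmf)
      (simp_all add: measure_pmf.emeasure_eq_measure)
  also have "\<dots> = ennreal (?P 1 * (1 / 2) + ?P 0 * (1 / 2))"
    by (subst ennreal_plus, simp, simp, subst (1 2) ennreal_mult'', simp_all)
  also have "?P 1 * (1 / 2) + ?P 0 * (1 / 2) = (measure_pmf.prob (random_extension l (2 * a + 1)) A + measure_pmf.prob (random_extension l (2 * a)) A) / 2"
    by (simp add: field_simps)
  finally have "emeasure (random_extension (Suc l) a) A = ennreal ((measure_pmf.prob (random_extension l (2 * a + 1)) A + measure_pmf.prob (random_extension l (2 * a)) A) / 2)" .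
  then have "measure_pmf.prob (random_extension (Suc l) a) A =
    (measure_pmf.prob (random_extension l (2 * a + 1)) A + measure_pmf.prob (random_extension l (2 * a)) A) / 2"
    by (simp only: measure_pmf.emeasure_eq_measure) (subst (asm) ennreal_inj, (assumption | simp)+)
  also have "\<dots> = (card (A \<inter> {(2 * a + 1) * 2 ^ l..<(2 * a + 2) * 2 ^ l}) + card (A \<inter> {2 * a * 2 ^ l..<(2 * a + 1) * 2 ^ l})) / 2 ^ Suc l"
    by (simp add: Suc.IH add_divide_distrib)
  also have "card (A \<inter> {(2 * a + 1) * 2 ^ l..<(2 * a + 2) * 2 ^ l}) + card (A \<inter> {2 * a * 2 ^ l..<(2 * a + 1) * 2 ^ l})
      = card (A \<inter> {a * 2 ^ Suc l..<(a + 1) * 2 ^ Suc l})"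
    by (subst card_Un_disjoint[symmetric]) (auto intro!: arg_cong[of _ _ card] simp: algebra_simps)
  finally show ?case .
qed

lemma prob_random_extension_mod_le:
  assumes "0 < p"
  shows "measure_pmf.prob (random_extension l 0) {x. x mod p = c} \<le> 1 / p + 1 / 2 ^ l"
proof -
  let ?N = "2 ^ l :: nat"
  \<comment> \<open>A member of the residue class is determined by its quotient by \<open>p\<close>,
    which takes at most \<open>?N div p + 1\<close> values; the extra 1 is the source of the error
    term in the bound.\<close>
  have "{x. x mod p = c} \<inter> {0..<?N} \<subseteq> (\<lambda>i. i * p + c) ` {..?N div p}"
  proof
    fix x assume "x \<in> {x. x mod p = c} \<inter> {0..<?N}"
    then have "x = x div p * p + c" "x div p \<le> ?N div p" by (auto simp: div_le_mono)
    then show "x \<in> (\<lambda>i. i * p + c) ` {..?N div p}" by blast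
  qed
  then have "card ({x. x mod p = c} \<inter> {0..<?N}) \<le> card {..?N div p}"
    by (rule surj_card_le[rotated]) simp
  then have "real (card ({x. x mod p = c} \<inter> {0..<?N})) \<le> real (?N div p) + 1" by simp
  also have "real (?N div p) \<le> ?N / p" by (rule of_nat_div_le_of_nat)
  finally have "real (card ({x. x mod p = c} \<inter> {0..<?N})) / 2 ^ l \<le> (?N / p + 1) / 2 ^ l"
    by (intro divide_right_mono) auto
  then show ?thesis by (simp add: prob_random_extension field_simps)
qed

section \<open>Additive functionals on the \<open>p\<close>-torsion of a finite abelian
  group\<close>

text \<open>
  A subgroup \<open>H\<close> of the \<open>p\<close>-torsion that is maximal with respect to not containing \<open>g\<close> has
  the powers of \<open>g\<close> as a complement; the functional reads off the exponent of \<open>g\<close>.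
\<close>

lemma (in comm_group) exists_functional_mod_prime:
  assumes "finite (carrier G)" "prime p" "g \<in> carrier G" "g [^] p = \<one>" "g \<noteq> \<one>"
  defines "V \<equiv> {x \<in> carrier G. x [^] p = \<one>}"
  obtains \<phi> :: "'a \<Rightarrow> int" where "\<And>x y. x \<in> V \<Longrightarrow> y \<in> V \<Longrightarrow> [\<phi> (x \<otimes> y) = \<phi> x + \<phi> y] (mod int p)"
    "[\<phi> g = 1] (mod int p)"
proof -
  \<comment> \<open>Closure under inverses is not demanded: in the \<open>p\<close>-torsion the
    inverse of \<open>x\<close> is its power with exponent \<open>p - 1\<close>.\<close>
  define C where "C = {H. H \<subseteq> V \<and> \<one> \<in> H \<and> (\<forall>x\<in>H. \<forall>y\<in>H. x \<otimes> y \<in> H) \<and> g \<notin> H}"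
  have "C \<subseteq> Pow (carrier G)" by (auto simp: C_def V_def)
  then have "finite C" using assms(1) finite_subset by blast
  moreover have "{\<one>} \<in> C" using assms by (auto simp: C_def)
  ultimately obtain H where H: "H \<in> C" "\<And>K. K \<in> C \<Longrightarrow> H \<subseteq> K \<Longrightarrow> K = H"
    by (metis finite_has_maximal empty_iff)
  have HV: "x \<in> H \<Longrightarrow> x \<in> carrier G" "x \<in> H \<Longrightarrow> x [^] p = \<one>" for x
    using H(1) by (auto simp: C_def V_def)
  have H1: "\<one> \<in> H" and Hm: "\<And>x y. x \<in> H \<Longrightarrow> y \<in> H \<Longrightarrow> x \<otimes> y \<in> H" and gH: "g \<notin> H"
    using H(1) by (auto simp: C_def)
  have Hpow: "x \<in> H \<Longrightarrow> x [^] (i::nat) \<in> H" for x i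
    by (induction i) (auto intro: H1 Hm)
  have pow_1_add: "x [^] (1 + p * w) = x" if "x \<in> carrier G" "x [^] p = \<one>" for x and w :: nat
    using that by (simp add: nat_pow_mult[symmetric] nat_pow_pow[symmetric])
  have Hinv: "inv x \<in> H" if "x \<in> H" for x
  proof -
    have "x \<otimes> x [^] (p - 1) = \<one>"
      using HV[OF that] nat_pow_mult[of x 1 "p - 1"] prime_gt_0_nat[OF assms(2)] by simp
    then have "inv x = x [^] (p - 1)"
      using HV[OF that] by (metis inv_unique' m_comm nat_pow_closed)
    then show ?thesis using Hpow[OF that] by simp
  qed
  have inverse: "\<exists>u w. i * u = 1 + p * w" if "\<not> p dvd i" for i
  proof -
    have "coprime i p" using that assms(2) by (metis coprime_commute prime_imp_coprime)
    then obtain u where "[i * u = 1] (mod p)" using cong_solve_coprime_nat by auto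
    then have "(i * u) mod p = 1" using prime_gt_1_nat[OF assms(2)] by (simp add: cong_def)
    then have "i * u = 1 + p * (i * u div p)" by (metis add.commute mult_div_mod_eq)
    then show ?thesis by blast
  qed
  \<comment> \<open>For \<open>x\<close> outside \<open>H\<close>, the larger set \<open>K\<close>
    generated by \<open>H\<close> and \<open>x\<close> must contain \<open>g\<close> by maximality,
    say as \<open>h\<close> times the \<open>i\<close>-th power of \<open>x\<close>. Here
    \<open>p\<close> cannot divide \<open>i\<close>, for then \<open>g\<close> would lie in
    \<open>H\<close>; inverting \<open>i\<close> modulo \<open>p\<close> solves for
    \<open>x\<close>.\<close>
  have ex: "\<exists>j. \<exists>h\<in>H. x = h \<otimes> g [^] (j::nat)" if x: "x \<in> V" for x
  proof (cases "x \<in> H")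
    case True
    then show ?thesis using HV by (intro exI[of _ 0] bexI[of _ x]) auto
  next
    case False
    have xc: "x \<in> carrier G" "x [^] p = \<one>" using x by (auto simp: V_def)
    define K where "K = {h \<otimes> x [^] (i::nat) | h i. h \<in> H}"
    have HK: "H \<subseteq> K" unfolding K_def using HV by (force intro: exI[of _ 0])
    have "\<one> \<otimes> x [^] (1::nat) \<in> K" unfolding K_def using H1 by blast
    then have "x \<in> K" using xc by simp
    have "K \<subseteq> V"
      using HV xc by (auto simp: K_def V_def pow_mult_distrib m_comm nat_pow_pow mult.commute[of _ p])
        (simp add: nat_pow_pow[symmetric])
    moreover have "a \<otimes> b \<in> K" if ab: "a \<in> K" "b \<in> K" for a b
    proof -
      obtain h i h' i' where "h \<in> H" "a = h \<otimes> x [^] (i::nat)" "h' \<in> H" "b = h' \<otimes> x [^] (i'::nat)"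
        using ab unfolding K_def by blast
      moreover from this have "a \<otimes> b = (h \<otimes> h') \<otimes> x [^] (i + i')"
        using HV xc by (simp add: nat_pow_mult[symmetric] m_ac)
      ultimately show ?thesis unfolding K_def using Hm by blast
    qed
    ultimately have "g \<in> K"
      using H(2)[of K] HK H1 \<open>x \<in> K\<close> False unfolding C_def by blast
    then obtain h i where hi: "h \<in> H" "g = h \<otimes> x [^] (i::nat)" unfolding K_def by blast
    have "\<not> p dvd i"
    proof
      assume "p dvd i"
      then have "x [^] i = \<one>" using xc by (auto simp: nat_pow_pow[symmetric])
      then show False using hi HV gH by simp
    qed
    then obtain u w where uw: "i * u = 1 + p * w" using inverse by blast
    have "g [^] u = h [^] u \<otimes> x [^] (i * u)"
      using hi HV xc by (simp add: pow_mult_distrib m_comm nat_pow_pow)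
    then have "g [^] u = h [^] u \<otimes> x" using pow_1_add[OF xc] uw by simp
    then have "x = inv (h [^] u) \<otimes> g [^] u"
      using hi HV xc by (simp add: inv_solve_left)
    then show ?thesis using Hinv Hpow hi(1) by blast
  qed
  \<comment> \<open>The power of \<open>g\<close> with exponent \<open>j - i\<close> lies in
    \<open>H\<close>. If \<open>p\<close> did not divide this exponent, a further power would be
    \<open>g\<close> itself, which \<open>H\<close> omits.\<close>
  have le: "[i = j] (mod p)" if "h \<in> H" "h' \<in> H" "h \<otimes> g [^] (i::nat) = h' \<otimes> g [^] (j::nat)" "i \<le> j" for h h' i j
  proof (rule ccontr)
    assume "\<not> [i = j] (mod p)"
    then have "\<not> p dvd (j - i)" using that(4) by (metis cong_altdef_nat cong_sym)
    then obtain u w where uw: "(j - i) * u = 1 + p * w" using inverse by blast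
    have "g [^] j = g [^] (j - i) \<otimes> g [^] i" using that(4) assms(3) by (simp add: nat_pow_mult)
    then have "h \<otimes> g [^] i = (h' \<otimes> g [^] (j - i)) \<otimes> g [^] i"
      using that HV assms(3) by (simp add: m_assoc)
    then have "h = h' \<otimes> g [^] (j - i)" using that HV assms(3) by simp
    then have "g [^] (j - i) = inv h' \<otimes> h"
      using that HV assms(3) by (simp add: inv_solve_left)
    then have "g [^] (j - i) \<in> H" using Hinv Hm that by simp
    then have "g [^] ((j - i) * u) \<in> H" using Hpow assms(3) by (simp add: nat_pow_pow[symmetric])
    then show False using gH pow_1_add[OF assms(3,4)] uw by simp
  qed
  have uniq: "[i = j] (mod p)" if "h \<in> H" "h' \<in> H" "h \<otimes> g [^] (i::nat) = h' \<otimes> g [^] (j::nat)" for h h' i j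
    using le[OF that] le[OF that(2,1) that(3)[symmetric]] by (metis cong_sym linear)
  \<comment> \<open>The exponent is determined only modulo \<open>p\<close>, so an arbitrary one is
    chosen and additivity is claimed as a congruence.\<close>
  define \<psi> where "\<psi> x = (SOME j::nat. \<exists>h\<in>H. x = h \<otimes> g [^] j)" for x
  have \<psi>: "\<exists>h\<in>H. x = h \<otimes> g [^] \<psi> x" if "x \<in> V" for x
    unfolding \<psi>_def using ex[OF that] by (rule someI_ex)
  have \<psi>_eq: "[\<psi> x = j] (mod p)" if "x \<in> V" "x = h \<otimes> g [^] j" "h \<in> H" for x j h
    using \<psi>[OF that(1)] that uniq by metis
  show ?thesis
  proof (rule that[of "\<lambda>x. int (\<psi> x)"])
    fix x y assume xy: "x \<in> V" "y \<in> V"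
    obtain h h' where h: "h \<in> H" "x = h \<otimes> g [^] \<psi> x" "h' \<in> H" "y = h' \<otimes> g [^] \<psi> y"
      using \<psi> xy by blast
    have "x \<otimes> y = (h \<otimes> g [^] \<psi> x) \<otimes> (h' \<otimes> g [^] \<psi> y)" using h by simp
    also have "\<dots> = (h \<otimes> h') \<otimes> g [^] (\<psi> x + \<psi> y)"
      using HV h(1,3) assms(3) by (simp add: nat_pow_mult[symmetric] m_ac)
    finally have "x \<otimes> y = (h \<otimes> h') \<otimes> g [^] (\<psi> x + \<psi> y)" .
    moreover have "x \<otimes> y \<in> V" using xy by (simp add: V_def pow_mult_distrib m_comm)
    ultimately have "[\<psi> (x \<otimes> y) = \<psi> x + \<psi> y] (mod p)" using \<psi>_eq Hm h by blast
    then show "[int (\<psi> (x \<otimes> y)) = int (\<psi> x) + int (\<psi> y)] (mod int p)"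
      by (metis cong_int_iff of_nat_add)
  next
    have "g = \<one> \<otimes> g [^] (1::nat)" "g \<in> V" using assms(3,4) by (auto simp: V_def)
    then have "[\<psi> g = 1] (mod p)" using \<psi>_eq H1 by blast
    then show "[int (\<psi> g) = 1] (mod int p)" by (metis cong_int_iff of_nat_1)
  qed
qed

section \<open>Reduction to a prime modulus\<close>

lemma add_pow_0: "add_pow R (0 :: nat) x = \<zero>\<^bsub>R\<^esub>"
  by (simp add: add_pow_def nat_pow_def)

lemma add_pow_Suc: "add_pow R (Suc k) x = add_pow R k x \<oplus>\<^bsub>R\<^esub> x"
  by (simp add: add_pow_def nat_pow_def)

lemma add_RDirProd_list_Cons:
  assumes "x \<in> carrier R" "y \<in> carrier R" "xs \<in> carrier (RDirProd_list Rs)" "ys \<in> carrier (RDirProd_list Rs)"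
  shows "(x # xs) \<oplus>\<^bsub>RDirProd_list (R # Rs)\<^esub> (y # ys) = (x \<oplus>\<^bsub>R\<^esub> y) # (xs \<oplus>\<^bsub>RDirProd_list Rs\<^esub> ys)"
  using ring_hom_add[OF RDirProd_list_hom1, of "(x, xs)" R Rs "(y, ys)"] assms
  by (simp add: RDirProd_carrier) (simp add: RDirProd_def DirProd_def monoid.defs)

lemma add_pow_one_RDirProd_list_eq_zero:
  assumes "\<And>S. S \<in> set Rs \<Longrightarrow> ring S \<and> add_pow S (k :: nat) \<one>\<^bsub>S\<^esub> = \<zero>\<^bsub>S\<^esub>"
  shows "add_pow (RDirProd_list Rs) k \<one>\<^bsub>RDirProd_list Rs\<^esub> = \<zero>\<^bsub>RDirProd_list Rs\<^esub>"
  using assms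
proof (induction Rs)
  case Nil
  show ?case by (induction k) (auto simp: add_pow_0 add_pow_Suc monoid.defs)
next
  case (Cons S Rs)
  let ?P = "RDirProd_list Rs"
  interpret S: ring S using Cons.prems by simp
  have "ring ?P" by (rule RDirProd_list_is_ring) (use Cons.prems in auto)
  then interpret P: ring ?P .
  have "add_pow (RDirProd_list (S # Rs)) j (\<one>\<^bsub>S\<^esub> # \<one>\<^bsub>?P\<^esub>) = add_pow S j \<one>\<^bsub>S\<^esub> # add_pow ?P j \<one>\<^bsub>?P\<^esub>" for j :: nat
  proof (induction j)
    case 0
    then show ?case by (simp add: add_pow_0 RDirProd_list_zero')
  next
    case (Suc j)
    then show ?case by (simp add: add_pow_Suc add_RDirProd_list_Cons)
  qed
  moreover have "\<one>\<^bsub>RDirProd_list (S # Rs)\<^esub> = \<one>\<^bsub>S\<^esub> # \<one>\<^bsub>?P\<^esub>"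
    by (simp add: RDirProd_list_one)
  ultimately show ?case using Cons by (simp add: RDirProd_list_zero')
qed

lemma ring_iso_add_pow_one_eq_zero:
  assumes "ring R" "ring S" "R \<simeq> S" "add_pow S (k :: nat) \<one>\<^bsub>S\<^esub> = \<zero>\<^bsub>S\<^esub>"
  shows "add_pow R k \<one>\<^bsub>R\<^esub> = \<zero>\<^bsub>R\<^esub>"
proof -
  interpret R: ring R by fact
  interpret S: ring S by fact
  obtain h where h: "h \<in> ring_hom R S" "inj_on h (carrier R)"
    using assms(3) by (auto simp: is_ring_iso_def ring_iso_def bij_betw_def)
  have h0: "h \<zero>\<^bsub>R\<^esub> = \<zero>\<^bsub>S\<^esub>" using ring_hom_zero[OF h(1) assms(1,2)] .
  have "h (add_pow R j \<one>\<^bsub>R\<^esub>) = add_pow S j \<one>\<^bsub>S\<^esub>" for j :: nat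
    by (induction j) (simp_all add: add_pow_0 add_pow_Suc h0 ring_hom_add[OF h(1)] ring_hom_one[OF h(1)])
  then show ?thesis using h(2) h0 assms(4) by (metis R.add.nat_pow_closed R.one_closed R.zero_closed inj_onD)
qed

section \<open>Supports of polynomials, values at integer points and torsion multiples\<close>

context ring
begin

lemma finite_support_indexed_pset:
  assumes "P \<in> indexed_pset I K"
  shows "finite {M. P M \<noteq> \<zero>}"
  using assms
proof induction
  case (indexed_const k)
  have "{M. indexed_const k M \<noteq> \<zero>} \<subseteq> {{#}}" by (auto simp: indexed_const_def)
  then show ?case using finite_subset by blast
next
  case (indexed_padd P Q)
  have "{M. indexed_padd P Q M \<noteq> \<zero>} \<subseteq> {M. P M \<noteq> \<zero>} \<union> {M. Q M \<noteq> \<zero>}"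
    by (auto simp: indexed_padd_def)
  then show ?case using indexed_padd.IH finite_subset by blast
next
  case (indexed_pmult P i)
  have "{M. indexed_pmult P i M \<noteq> \<zero>} \<subseteq> add_mset i ` {M. P M \<noteq> \<zero>}"
    by (auto simp: indexed_pmult_def image_iff intro!: exI[of _ "_ - {#i#}"] split: if_splits)
  then show ?case using indexed_pmult.IH finite_surj by blast
qed

lemma set_mset_subset_indexed_pset:
  assumes "P \<in> indexed_pset I K" "P M \<noteq> \<zero>"
  shows "set_mset M \<subseteq> I"
  using assms
proof (induction arbitrary: M)
  case (indexed_padd P Q)
  then have "P M \<noteq> \<zero> \<or> Q M \<noteq> \<zero>" by (auto simp: indexed_padd_def)
  then show ?case using indexed_padd.IH by blast
next
  case (indexed_pmult P i)
  then have "i \<in># M" "P (M - {#i#}) \<noteq> \<zero>" by (auto simp: indexed_pmult_def split: if_splits)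
  then have "set_mset (M - {#i#}) \<subseteq> I" by (metis indexed_pmult.IH)
  then show ?case using \<open>i \<in># M\<close> indexed_pmult.hyps
    by (metis insert_DiffM insert_subset set_mset_add_mset_insert)
qed (auto simp: indexed_const_def split: if_splits)

lemma add_pow_finsum:
  assumes "g \<in> A \<rightarrow> carrier R"
  shows "add_pow R (k :: nat) (finsum R g A) = (\<Oplus>x\<in>A. add_pow R k (g x))"
  using assms
proof (induction A rule: infinite_finite_induct)
  case (insert x A)
  then have "g x \<in> carrier R" "g \<in> A \<rightarrow> carrier R" by auto
  with insert show ?case by (simp add: add.nat_pow_distrib add.finprod_closed Pi_iff)
qed (simp_all)

end

context cring
begin

lemma nat_pow_add_pow_one: "add_pow R (a :: nat) \<one> [^] (j :: nat) = add_pow R (a ^ j) \<one>"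
proof (induction j)
  case (Suc j)
  have "add_pow R (a ^ j) \<one> \<otimes> add_pow R a \<one> = add_pow R (a ^ j) (add_pow R a \<one>)"
    by (simp add: add_pow_ldistr)
  also have "\<dots> = add_pow R (a * a ^ j) \<one>" by (simp add: add.nat_pow_pow)
  finally show ?case using Suc by simp
qed simp

lemma finprod_add_pow_one: "finite A \<Longrightarrow> finprod R (\<lambda>i. add_pow R (w i :: nat) \<one>) A = add_pow R (\<Prod>i\<in>A. w i) \<one>"
proof (induction A rule: finite_induct)
  case (insert x A)
  have "add_pow R (w x) \<one> \<otimes> add_pow R (\<Prod>i\<in>A. w i) \<one> = add_pow R (w x) (add_pow R (\<Prod>i\<in>A. w i) \<one>)"
    by (simp add: add_pow_ldistr)
  also have "\<dots> = add_pow R ((\<Prod>i\<in>A. w i) * w x) \<one>" by (simp add: add.nat_pow_pow)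
  finally show ?case using insert by (simp add: mult.commute)
qed simp

text \<open>At integer multiples of one every monomial is an integer multiple of one, so the value
  is an integer combination of the coefficients. Only the additive group of the ring is then
  involved, which is what makes an additive functional applicable.\<close>

lemma mpoly_eval_integer_point:
  assumes "f \<in> mpolys R n" "length as = n"
  shows "mpoly_eval R f (map (\<lambda>a :: nat. add_pow R a \<one>) as)
    = (\<Oplus>M\<in>{M. f M \<noteq> \<zero>}. add_pow R (\<Prod>i<n. as ! i ^ count M i) (f M))"
proof -
  have fM: "f M \<in> carrier R" for M
    using indexed_pset_in_carrier[of "carrier R" f] assms(1) carrier_coeffE unfolding mpolys_def by blast
  have vars: "set_mset M \<subseteq> {..<n}" if "f M \<noteq> \<zero>" for M
    using set_mset_subset_indexed_pset that assms(1) unfolding mpolys_def by blast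
  show ?thesis
    unfolding mpoly_eval_def
  proof (rule finsum_cong')
    fix M assume M: "M \<in> {M. f M \<noteq> \<zero>}"
    have "(\<Otimes>i\<in>set_mset M. map (\<lambda>a. add_pow R a \<one>) as ! i [^] count M i)
        = (\<Otimes>i\<in>set_mset M. add_pow R (as ! i ^ count M i) \<one>)"
      using vars[of M] M assms(2) by (intro finprod_cong') (auto simp: nat_pow_add_pow_one subset_iff)
    also have "\<dots> = add_pow R (\<Prod>i\<in>set_mset M. as ! i ^ count M i) \<one>"
      by (simp add: finprod_add_pow_one)
    \<comment> \<open>Variables absent from \<open>M\<close> have exponent 0 and contribute the
      factor 1, even where the point is 0.\<close>
    also have "(\<Prod>i\<in>set_mset M. as ! i ^ count M i) = (\<Prod>i<n. as ! i ^ count M i)"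
      using vars[of M] M by (intro prod.mono_neutral_left) (auto simp: not_in_iff)
    finally show "f M \<otimes> (\<Otimes>i\<in>set_mset M. map (\<lambda>a. add_pow R a \<one>) as ! i [^] count M i)
        = add_pow R (\<Prod>i<n. as ! i ^ count M i) (f M)"
      using fM by (simp add: add_pow_rdistr)
  qed (use fM in auto)
qed

text \<open>If \<open>k\<close> is the least positive annihilator of all coefficients and \<open>p\<close> divides \<open>k\<close>, take \<open>t = k / p\<close>.\<close>

lemma exists_torsion_multiple:
  assumes carr: "\<And>M. f M \<in> carrier R" and "f M0 \<noteq> \<zero>" and N: "add_pow R (N :: nat) \<one> = \<zero>" "N > 0"
  shows "\<exists>(t :: nat) p M. prime p \<and> p dvd N \<and> add_pow R t (f M) \<noteq> \<zero> \<and>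
    (\<forall>M. add_pow R p (add_pow R t (f M)) = \<zero>)"
proof -
  define k where "k = (LEAST k. 0 < k \<and> (\<forall>M. add_pow R (k :: nat) (f M) = \<zero>))"
  have "add_pow R N (f M) = \<zero>" for M
    using add_pow_rdistr[of "f M" \<one> N] carr[of M] N by simp
  then have NN: "0 < N \<and> (\<forall>M. add_pow R N (f M) = \<zero>)" using N by simp
  from LeastI[of "\<lambda>k. 0 < k \<and> (\<forall>M. add_pow R (k :: nat) (f M) = \<zero>)", OF NN]
  have k: "0 < k" "\<And>M. add_pow R k (f M) = \<zero>" unfolding k_def by auto
  have least: "\<exists>M. add_pow R j (f M) \<noteq> \<zero>" if "0 < j" "j < k" for j
    using not_less_Least[of j "\<lambda>k. 0 < k \<and> (\<forall>M. add_pow R (k :: nat) (f M) = \<zero>)"] that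
    unfolding k_def[symmetric] by blast
  have "k \<noteq> 1" using k(2)[of M0] carr[of M0] assms(2) by auto
  then obtain p where p: "prime p" "p dvd k" using prime_factor_nat by blast
  \<comment> \<open>Otherwise the remainder \<open>N mod k\<close> would be a smaller positive
    annihilator of all coefficients.\<close>
  have "k dvd N"
  proof (rule ccontr)
    assume "\<not> k dvd N"
    then have "0 < N mod k" "N mod k < k" using k(1) by (auto simp: mod_greater_zero_iff_not_dvd)
    then obtain M where "add_pow R (N mod k) (f M) \<noteq> \<zero>" using least by blast
    moreover have "add_pow R N (f M) = add_pow R (k * (N div k)) (f M) \<oplus> add_pow R (N mod k) (f M)"
      using carr by (simp add: add.nat_pow_mult)
    moreover have "add_pow R (k * (N div k)) (f M) = \<zero>"
      using carr k(2) by (simp flip: add.nat_pow_pow)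
    ultimately show False using NN carr by simp
  qed
  obtain t where t: "k = p * t" using p(2) by (elim dvdE)
  with k(1) have "0 < t" "t < k" using prime_gt_1_nat[OF p(1)] by auto
  with least obtain M where M: "add_pow R t (f M) \<noteq> \<zero>" by blast
  have "p dvd N" using p(2) \<open>k dvd N\<close> dvd_trans by blast
  moreover have "\<forall>M. add_pow R p (add_pow R t (f M)) = \<zero>"
    using k(2) carr t by (simp add: add.nat_pow_pow mult.commute)
  ultimately show ?thesis using p(1) M by blast
qed

text \<open>The prime depends on the polynomial but is fixed before the distribution
  \<open>D\<close>. Its bound by the size of the ring later allows a sampling range that is chosen
  without knowing the prime.\<close>

lemma prob_mpoly_eval_eq_zero_le:
  assumes fin: "finite (carrier R)" and f: "f \<in> mpolys R n" "total_degree_le R f d" "f \<noteq> zero_mpoly R"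
    and N: "add_pow R (N :: nat) \<one> = \<zero>" "N > 0"
  obtains p where "prime p" "p dvd N" "p \<le> card (carrier R)"
    "\<And>D \<delta>. (\<And>c. measure_pmf.prob D {x. x mod p = c} \<le> \<delta>) \<Longrightarrow>
      measure_pmf.prob (iid_list n D) {as. mpoly_eval R f (map (\<lambda>a. add_pow R a \<one>) as) = \<zero>}
        \<le> real n * real d * \<delta>"
proof -
  have carr: "f M \<in> carrier R" for M
    using indexed_pset_in_carrier[of "carrier R" f] f(1) carrier_coeffE unfolding mpolys_def by blast
  obtain M1 where "f M1 \<noteq> \<zero>"
    using f(3) by (auto simp: zero_mpoly_def indexed_zero_def fun_eq_iff)
  then obtain t p :: nat and M0 where p: "prime p" "p dvd N" and M0: "add_pow R t (f M0) \<noteq> \<zero>"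
    and tor: "\<And>M. add_pow R p (add_pow R t (f M)) = \<zero>"
    using exists_torsion_multiple[of f M1 N, OF carr _ N] by blast
  define g where "g = (\<lambda>M. add_pow R t (f M))"
  have g: "g M \<in> carrier R" for M using carr by (simp add: g_def)
  define V where "V = {x \<in> carrier R. add_pow R p x = \<zero>}"
  have gV: "g M \<in> V" for M using g tor by (simp add: V_def g_def)
  \<comment> \<open>The support of \<open>f\<close> rather than of \<open>g\<close> is used, to
    agree with the index set of \<open>mpoly_eval\<close>; indices where \<open>g\<close> vanishes
    do no harm.\<close>
  define S where "S = {M. f M \<noteq> \<zero>}"
  have S: "finite S" using finite_support_indexed_pset f(1) unfolding S_def mpolys_def by blast
  obtain \<phi> where \<phi>: "\<And>x y. x \<in> V \<Longrightarrow> y \<in> V \<Longrightarrow> [\<phi> (x \<oplus> y) = \<phi> x + \<phi> y] (mod int p)"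
    "[\<phi> (g M0) = 1] (mod int p)"
    using add.exists_functional_mod_prime[of p "g M0"] fin p(1) g tor M0
    unfolding V_def g_def by (metis (lifting))
  have V0: "\<zero> \<in> V" and Vadd: "\<And>x y. x \<in> V \<Longrightarrow> y \<in> V \<Longrightarrow> x \<oplus> y \<in> V"
    by (auto simp: V_def add.nat_pow_distrib)
  have \<phi>0: "[\<phi> \<zero> = 0] (mod int p)"
    using \<phi>(1)[OF V0 V0] by (simp add: cong_iff_dvd_diff)
  have Vpow: "add_pow R k x \<in> V \<and> [\<phi> (add_pow R k x) = int k * \<phi> x] (mod int p)" if "x \<in> V" for x and k :: nat
  proof (induction k)
    case 0
    then show ?case using V0 \<phi>0 by (simp add: add_pow_0)
  next
    case (Suc k)
    then have "[\<phi> (add_pow R k x \<oplus> x) = \<phi> (add_pow R k x) + \<phi> x] (mod int p)" using \<phi>(1) that by blast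
    also have "[\<phi> (add_pow R k x) + \<phi> x = int k * \<phi> x + \<phi> x] (mod int p)" using Suc by (intro cong_add) auto
    finally show ?case using Suc that Vadd by (simp add: add_pow_Suc algebra_simps)
  qed
  have \<phi>_sum: "(\<Oplus>M\<in>A. add_pow R (w M) (g M)) \<in> V \<and>
      [\<phi> (\<Oplus>M\<in>A. add_pow R (w M) (g M)) = (\<Sum>M\<in>A. int (w M) * \<phi> (g M))] (mod int p)"
    if "finite A" for A and w :: "nat multiset \<Rightarrow> nat"
    using that
  proof induction
    case empty
    then show ?case using V0 \<phi>0 by simp
  next
    case (insert M A)
    let ?x = "add_pow R (w M) (g M)" and ?y = "\<Oplus>M\<in>A. add_pow R (w M) (g M)"
    have x: "?x \<in> V" "[\<phi> ?x = int (w M) * \<phi> (g M)] (mod int p)" using Vpow[OF gV] by auto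
    have eq: "(\<Oplus>M\<in>insert M A. add_pow R (w M) (g M)) = ?x \<oplus> ?y"
      using insert g by simp
    have "[\<phi> (?x \<oplus> ?y) = \<phi> ?x + \<phi> ?y] (mod int p)" using \<phi>(1) x insert by blast
    also have "[\<phi> ?x + \<phi> ?y = int (w M) * \<phi> (g M) + (\<Sum>M\<in>A. int (w M) * \<phi> (g M))] (mod int p)"
      using x insert by (intro cong_add) auto
    finally show ?case using insert x Vadd unfolding eq by simp
  qed
  have zero: "int p dvd (\<Sum>M\<in>S. \<phi> (g M) * (\<Prod>i<n. int (as ! i) ^ count M i))"
    if "mpoly_eval R f (map (\<lambda>a. add_pow R a \<one>) as) = \<zero>" "length as = n" for as :: "nat list"
  proof -
    let ?w = "\<lambda>M. \<Prod>i<n. as ! i ^ count M i"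
    \<comment> \<open>Multiplying the vanishing value by \<open>t\<close> turns the coefficients
      \<open>f M\<close> into the torsion elements \<open>g M\<close>, and additivity of \<phi> is
      known only on torsion elements.\<close>
    have "\<zero> = add_pow R t (\<Oplus>M\<in>S. add_pow R (?w M) (f M))"
      using that mpoly_eval_integer_point[OF f(1), of as] by (simp add: S_def)
    also have "\<dots> = (\<Oplus>M\<in>S. add_pow R t (add_pow R (?w M) (f M)))"
      using carr by (intro add_pow_finsum) auto
    also have "\<dots> = (\<Oplus>M\<in>S. add_pow R (?w M) (g M))"
      using carr by (intro finsum_cong') (auto simp: g_def add.nat_pow_pow mult.commute)
    finally have "[0 = (\<Sum>M\<in>S. int (?w M) * \<phi> (g M))] (mod int p)"
      using \<phi>_sum[OF S, of ?w] \<phi>0 by (metis cong_sym cong_trans)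
    then have "int p dvd (\<Sum>M\<in>S. int (?w M) * \<phi> (g M))"
      by (metis cong_0_iff cong_sym)
    then show ?thesis by (simp add: mult.commute)
  qed
  have M0S: "M0 \<in> S" using M0 by (auto simp: S_def)
  have nz: "\<not> int p dvd \<phi> (g M0)"
    using \<phi>(2) prime_gt_1_nat[OF p(1)] by (metis cong_dvd_iff int_dvd_int_iff nat_dvd_1_iff_1 of_nat_1 less_irrefl)
  have sep: "M = M'" if "M \<in> S" "M' \<in> S" "\<forall>i<n. count M i = count M' i" for M M'
  proof (rule multiset_eqI)
    fix i
    have "set_mset M \<subseteq> {..<n}" "set_mset M' \<subseteq> {..<n}"
      using set_mset_subset_indexed_pset that(1,2) f(1) unfolding mpolys_def S_def by blast+
    with that(3) show "count M i = count M' i" by (metis lessThan_iff not_in_iff subsetD)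
  qed
  have deg: "count M i \<le> d" if "M \<in> S" for M i
    using f(2) that count_le_size[of M i] unfolding total_degree_le_def S_def by (meson le_trans mem_Collect_eq)
  have bound: "measure_pmf.prob (iid_list n D) {as. mpoly_eval R f (map (\<lambda>a. add_pow R a \<one>) as) = \<zero>}
        \<le> real n * real d * \<delta>"
    if "\<And>c. measure_pmf.prob D {x. x mod p = c} \<le> \<delta>" for D \<delta>
  proof -
    have "measure_pmf.prob (iid_list n D) {as. mpoly_eval R f (map (\<lambda>a. add_pow R a \<one>) as) = \<zero>}
      \<le> measure_pmf.prob (iid_list n D) {as. int p dvd (\<Sum>M\<in>S. \<phi> (g M) * (\<Prod>i<n. int (as ! i) ^ count M i))}"
      by (rule measure_pmf.finite_measure_mono_AE) (auto simp: AE_measure_pmf_iff intro: zero length_iid_list)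
    also have "\<dots> \<le> real n * real d * \<delta>"
      by (rule prob_poly_mod_prime_eq_0_le[OF p(1) S M0S]) (use nz sep deg that in auto)
    finally show ?thesis .
  qed
  have "p \<le> card (carrier R)"
  proof -
    \<comment> \<open>The element \<open>g M0\<close> is nonzero and killed by \<open>p\<close>, so
      its additive order is exactly \<open>p\<close>, and an order is at most the size of the
      group.\<close>
    have "add.ord (g M0) dvd p" using add.pow_eq_id[of "g M0" p] gV[of M0] by (simp add: V_def)
    moreover have "add.ord (g M0) \<noteq> 1" using add.ord_eq_1[of "g M0"] g M0 by (simp add: g_def)
    ultimately have "add.ord (g M0) = p" using p(1) prime_nat_iff by blast
    then show ?thesis using add.ord_le_group_order[of "g M0"] fin g by (simp add: Coset.order_def)
  qed
  with p bound show ?thesis using that by blast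
qed

end

section \<open>The testing program\<close>

text \<open>Popping the empty register 7 only pads the two outcomes of a comparison to equal length.\<close>

definition compare_body :: program where
  "compare_body =
     [Branch 10 [] [Branch 3 [] [Pop 7, Pop 7] [Pop 0, Push 0 False]]
        [Branch 3 [] [Pop 0, Push 0 False] [Pop 7, Pop 7]], Pop 10, Pop 3]"

text \<open>Every path through the body takes seven steps including the loop test. Register 0
  accumulates the conjunction of the bit comparisons; equal lengths ensure that the inner branch
  never meets an empty register.\<close>

lemma exec_compare:
  assumes "length (s 10) = length (s 3)" "s 0 = [b]" "s 7 = []"
  shows "exec orc (7 * length (s 10) + 1) [While 10 compare_body] s
    (return_pmf (s(0 := [b \<and> s 10 = s 3], 3 := [], 10 := [])))"
  using assms
proof (induction "s 10" arbitrary: s b)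
  case Nil
  then have "s(0 := [b \<and> s 10 = s 3], 3 := [], 10 := []) = s" by (auto simp: fun_eq_iff)
  with exec_While_Nil[of s 10, OF _ exec_Nil] Nil show ?case by (simp del: fun_upd_apply)
next
  case (Cons x u)
  have s: "s 10 = x # u" using Cons(2) by simp
  with Cons.prems(1) obtain y v where v: "s 3 = y # v" by (metis length_Suc_conv)
  let ?s = "s(0 := [b \<and> x = y], 3 := v, 10 := u)"
  have "u = ?s 10" by simp
  note IH = Cons(1)[of ?s "b \<and> x = y", OF this]
  have r: "?s(0 := [(b \<and> x = y) \<and> ?s 10 = ?s 3], 3 := [], 10 := []) = s(0 := [b \<and> s 10 = s 3], 3 := [], 10 := [])"
    using s v by (auto simp: fun_eq_iff)
  have IH: "exec orc (7 * length u + 1) [While 10 compare_body] ?s (return_pmf (s(0 := [b \<and> s 10 = s 3], 3 := [], 10 := [])))"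
    using IH Cons.prems s v unfolding r by simp
  have c1: "s(0 := [False], 10 := u, 3 := v) = ?s" if "\<not> (x = y)"
    using that Cons.prems by (auto simp: fun_eq_iff)
  have c2: "s(10 := u, 3 := v) = ?s" if "x = y"
    using that Cons.prems by (auto simp: fun_eq_iff)
  have s7: "s(7 := []) = s" using Cons.prems by (auto simp: fun_eq_iff)
  have "exec orc (Suc (Suc (Suc (Suc (Suc (Suc (Suc (7 * length u + 1)))))))) [While 10 compare_body] s
    (return_pmf (s(0 := [b \<and> s 10 = s 3], 3 := [], 10 := [])))"
    apply (rule exec_While_Cons)
     apply (simp add: s)
    apply (subst (1) compare_body_def)
    apply (simp only: append.simps)
    apply (rule exec_Branch)
    using IH s v Cons.prems s7 c1 c2
    by (cases x; cases y) (auto simp del: fun_upd_apply simp: fun_upd_same fun_upd_other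
        intro!: exec_Branch exec_Pop exec_Push)
  moreover have "Suc (Suc (Suc (Suc (Suc (Suc (Suc (7 * length u + 1))))))) = 7 * length (s 10) + 1" by (simp add: s)
  ultimately show ?case by (simp only:)
qed

text \<open>One round of double-and-add: register 8 first holds the element in register 5 twice, for
  the doubling query, and then one or zero in front of the double, according to the coin.\<close>

definition extend_bit :: program where
  "extend_bit = [Pop 6] @ copy 5 8 @ prepend 5 8 @
     [Call RingAdd 8, Flip 9, Branch 9 [] (Pop 9 # copy 4 8) (Pop 9 # copy 3 8), Call RingAdd 8] @
     prepend 8 5"

text \<open>Of the \<open>m + e\<close> coin tosses, \<open>m\<close> are counted by a copy of the
  unary input, while the other \<open>e\<close> are pushes written into the program text. Thus the
  program depends on \<open>e\<close> only.\<close>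

definition sample_point :: "nat \<Rightarrow> program" where
  "sample_point e = [Pop 0] @ copy 3 5 @ copy 2 6 @ replicate e (Push 6 True) @ [While 6 extend_bit] @ prepend 5 10"

definition pit :: "nat \<Rightarrow> program" where
  "pit e = [While 0 (sample_point e)] @ [Push 0 True, Call EvalPoly 10] @ [While 10 compare_body]"

section \<open>Exact output distributions of the program on an oracle ring\<close>

locale oracle_ring = cring R for R :: "bool list ring" (structure) +
  fixes m :: nat and orc :: oracles
  assumes carrier_length: "x \<in> carrier R \<Longrightarrow> length x = m"
    and ring_oracle: "ring_oracle R orc"
begin

definition elt :: "nat \<Rightarrow> bool list" where
  "elt a = add_pow R a \<one>"

lemma elt_carrier [simp]: "elt a \<in> carrier R"
  by (simp add: elt_def)

lemma length_elt [simp]: "length (elt a) = m"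
  by (simp add: carrier_length)

lemma length_zero_one [simp]: "length \<zero> = m" "length \<one> = m"
  by (simp_all add: carrier_length)

lemma add_query [simp]: "x \<in> carrier R \<Longrightarrow> y \<in> carrier R \<Longrightarrow> orc RingAdd (x @ y) = x \<oplus> y"
  using ring_oracle by (simp add: ring_oracle_def)

lemma elt_0: "elt 0 = \<zero>"
  by (simp add: elt_def)

lemma elt_double: "(if b then \<one> else \<zero>) \<oplus> (elt a \<oplus> elt a) = elt (2 * a + of_bool b)"
proof -
  have "elt a \<oplus> elt a = add_pow R (2 * a) \<one>"
    unfolding elt_def by (simp add: add.nat_pow_mult mult_2)
  then show ?thesis
    unfolding elt_def by (cases b) (simp_all add: a_comm)
qed

text \<open>
  Registers 0 to 4 hold the input, 5 the integer sampled so far as a ring element, 6 a unary loop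
  counter, 8 a ring query and 10 the evaluation query; 7 and 9 are scratch.
\<close>

definition st :: "nat \<Rightarrow> bool list \<Rightarrow> bool list \<Rightarrow> nat \<Rightarrow> bool list \<Rightarrow> store" where
  "st d w x l q = (\<lambda>_. [])(0 := w, 1 := replicate d True, 2 := replicate m True, 3 := \<zero>, 4 := \<one>,
     5 := x, 6 := replicate l True, 10 := q)"

text \<open>The linear term of the cost comes from two copies at \<open>9 * m\<close> and two
  prepends at \<open>8 * m\<close> steps each.\<close>

lemma exec_extend_bit:
  "exec orc (34 * m + 14) extend_bit (st d w (elt a) (Suc l) q)
     (map_pmf (\<lambda>b. st d w (elt (2 * a + of_bool b)) l q) (bernoulli_pmf (1 / 2)))"
proof -
  let ?s = "st d w (elt a) l q"
  let ?y = "elt a \<oplus> elt a"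
  let ?s2 = "?s(5 := [], 8 := ?y)"
  have 1: "exec orc 1 [Pop 6] (st d w (elt a) (Suc l) q) (return_pmf ?s)"
  proof -
    have "(st d w (elt a) (Suc l) q)(6 := tl (st d w (elt a) (Suc l) q 6)) = ?s"
      by (auto simp: st_def fun_eq_iff)
    then show ?thesis using exec_Pop[OF exec_Nil] by (metis One_nat_def)
  qed
  have 2: "exec orc (9 * m + 2) (copy 5 8) ?s (return_pmf (?s(8 := elt a)))"
    using exec_copy[of 5 8 ?s orc] by (simp add: st_def)
  have 3: "exec orc (8 * m + 2) (prepend 5 8) (?s(8 := elt a)) (return_pmf (?s(5 := [], 8 := elt a @ elt a)))"
  proof -
    have "(?s(8 := elt a))(5 := [], 8 := (?s(8 := elt a)) 5 @ (?s(8 := elt a)) 8) = ?s(5 := [], 8 := elt a @ elt a)"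
      by (auto simp: st_def fun_eq_iff)
    then show ?thesis using exec_prepend[of 5 8 "?s(8 := elt a)" orc] by (simp add: st_def)
  qed
  have 4: "exec orc (17 * m + 9)
      ([Call RingAdd 8, Flip 9, Branch 9 [] (Pop 9 # copy 4 8) (Pop 9 # copy 3 8), Call RingAdd 8] @ prepend 8 5)
      (?s(5 := [], 8 := elt a @ elt a))
      (bind_pmf (bernoulli_pmf (1 / 2)) (\<lambda>b. return_pmf (st d w (elt (2 * a + of_bool b)) l q)))"
  proof -
    have a: "exec orc (9 * m + 2) (copy (if b then 4 else 3) 8) ?s2
      (return_pmf (?s2(8 := (if b then \<one> else \<zero>) @ ?y)))" for b
      using exec_copy[of "if b then 4 else 3" 8 ?s2 orc] by (cases b) (simp_all add: st_def)
    have b: "exec orc (8 * m + 2) (prepend 8 5) (?s2(8 := elt (2 * a + of_bool b)))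
      (return_pmf (st d w (elt (2 * a + of_bool b)) l q))" for b
    proof -
      let ?s3 = "?s2(8 := elt (2 * a + of_bool b))"
      have "?s3(8 := [], 5 := ?s3 8 @ ?s3 5) = st d w (elt (2 * a + of_bool b)) l q"
        by (auto simp: st_def fun_eq_iff)
      then show ?thesis using exec_prepend[of 8 5 ?s3 orc] by (simp add: st_def)
    qed
    have "exec orc (Suc (8 * m + 2)) (Call RingAdd 8 # prepend 8 5) (?s2(8 := (if b then \<one> else \<zero>) @ ?y))
      (return_pmf (st d w (elt (2 * a + of_bool b)) l q))" for b
    proof (rule exec_Call)
      have "(?s2(8 := (if b then \<one> else \<zero>) @ ?y))
          (8 := orc RingAdd ((?s2(8 := (if b then \<one> else \<zero>) @ ?y)) 8)) = ?s2(8 := elt (2 * a + of_bool b))"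
        unfolding elt_double[symmetric] by (auto simp: fun_eq_iff)
      then show "exec orc (8 * m + 2) (prepend 8 5) ((?s2(8 := (if b then \<one> else \<zero>) @ ?y))
          (8 := orc RingAdd ((?s2(8 := (if b then \<one> else \<zero>) @ ?y)) 8)))
        (return_pmf (st d w (elt (2 * a + of_bool b)) l q))" using b by (simp only:)
    qed
    note c = exec_append[OF a this refl]
    have "exec orc (Suc (Suc (9 * m + 2 + Suc (8 * m + 2))))
        (Branch 9 [] (Pop 9 # copy 4 8) (Pop 9 # copy 3 8) # Call RingAdd 8 # prepend 8 5)
        (?s2(9 := b # ?s2 9)) (return_pmf (st d w (elt (2 * a + of_bool b)) l q))" for b
    proof (rule exec_Branch)
      have "(?s2(9 := b # ?s2 9))(9 := tl ((?s2(9 := b # ?s2 9)) 9)) = ?s2"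
        by (auto simp: fun_eq_iff)
      with c[of b] have "exec orc (Suc (9 * m + 2 + Suc (8 * m + 2)))
        (Pop 9 # copy (if b then 4 else 3) 8 @ Call RingAdd 8 # prepend 8 5)
        (?s2(9 := b # ?s2 9)) (return_pmf (st d w (elt (2 * a + of_bool b)) l q))"
        by (intro exec_Pop) (simp only:)
      then show "exec orc (Suc (9 * m + 2 + Suc (8 * m + 2)))
        ((case (?s2(9 := b # ?s2 9)) 9 of [] \<Rightarrow> []
          | b # _ \<Rightarrow> if b then Pop 9 # copy 4 8 else Pop 9 # copy 3 8) @ Call RingAdd 8 # prepend 8 5)
        (?s2(9 := b # ?s2 9)) (return_pmf (st d w (elt (2 * a + of_bool b)) l q))"
        by (cases b) (simp_all del: fun_upd_apply add: fun_upd_same)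
    qed
    note d = exec_Flip[OF this]
    have "(?s(5 := [], 8 := elt a @ elt a))(8 := orc RingAdd ((?s(5 := [], 8 := elt a @ elt a)) 8)) = ?s2"
      by (auto simp: fun_eq_iff)
    with d have "exec orc (Suc (Suc (Suc (Suc (9 * m + 2 + Suc (8 * m + 2))))))
      (Call RingAdd 8 # Flip 9 # Branch 9 [] (Pop 9 # copy 4 8) (Pop 9 # copy 3 8) # Call RingAdd 8 # prepend 8 5)
      (?s(5 := [], 8 := elt a @ elt a))
      (bind_pmf (bernoulli_pmf (1 / 2)) (\<lambda>b. return_pmf (st d w (elt (2 * a + of_bool b)) l q)))"
      by (intro exec_Call) (simp only:)
    moreover have "Suc (Suc (Suc (Suc (9 * m + 2 + Suc (8 * m + 2))))) = 17 * m + 9" by simp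
    ultimately show ?thesis by (simp only: append.simps)
  qed
  show ?thesis
    unfolding extend_bit_def map_pmf_def
    by (rule exec_append[OF 1 exec_append[OF 2 exec_append[OF 3 4 refl] refl]]) simp
qed

lemma exec_extend_bits:
  "exec orc (l * (34 * m + 15) + 1) [While 6 extend_bit] (st d w (elt a) l q)
     (map_pmf (\<lambda>c. st d w (elt c) 0 q) (random_extension l a))"
proof (induction l arbitrary: a)
  case 0
  then show ?case by (auto simp: st_def intro: exec_While_Nil exec_Nil)
next
  case (Suc l)
  have "exec orc (Suc (34 * m + 14 + (l * (34 * m + 15) + 1))) [While 6 extend_bit] (st d w (elt a) (Suc l) q)
     (bind_pmf (bernoulli_pmf (1 / 2)) (\<lambda>b. map_pmf (\<lambda>c. st d w (elt c) 0 q) (random_extension l (2 * a + of_bool b))))"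
    by (rule exec_While_Cons, simp add: st_def, rule exec_append_bind[OF exec_extend_bit Suc])
  moreover have "Suc (34 * m + 14 + (l * (34 * m + 15) + 1)) = Suc l * (34 * m + 15) + 1" by simp
  ultimately show ?case by (simp only: random_extension.simps map_bind_pmf)
qed

definition sample_time :: "nat \<Rightarrow> nat" where
  "sample_time e = 26 * m + 8 + e + (m + e) * (34 * m + 15)"

lemma exec_push_replicate:
  "exec orc e (replicate e (Push 6 True)) (st d w x l q) (return_pmf (st d w x (l + e) q))"
proof (induction e arbitrary: l)
  case (Suc e)
  have "(st d w x l q)(6 := True # st d w x l q 6) = st d w x (Suc l) q"
    by (auto simp: st_def fun_eq_iff)
  with Suc[of "Suc l"] show ?case by (auto intro!: exec_Push simp del: fun_upd_apply)
qed (simp add: exec_Nil)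

lemma exec_sample_point:
  "exec orc (sample_time e) (sample_point e) (st d (b # w) [] 0 q)
     (map_pmf (\<lambda>a. st d w [] 0 (elt a @ q)) (random_extension (m + e) 0))"
proof -
  have 1: "exec orc 1 [Pop 0] (st d (b # w) [] 0 q) (return_pmf (st d w [] 0 q))"
  proof -
    have "(st d (b # w) [] 0 q)(0 := tl (st d (b # w) [] 0 q 0)) = st d w [] 0 q"
      by (auto simp: st_def fun_eq_iff)
    then show ?thesis using exec_Pop[OF exec_Nil] by (metis One_nat_def)
  qed
  have 2: "exec orc (9 * m + 2) (copy 3 5) (st d w [] 0 q) (return_pmf (st d w (elt 0) 0 q))"
  proof -
    have "(st d w [] 0 q)(5 := st d w [] 0 q 3 @ st d w [] 0 q 5) = st d w (elt 0) 0 q"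
      by (auto simp: st_def fun_eq_iff elt_0)
    then show ?thesis using exec_copy[of 3 5 "st d w [] 0 q" orc] by (simp add: st_def)
  qed
  have 3: "exec orc (9 * m + 2) (copy 2 6) (st d w (elt 0) 0 q) (return_pmf (st d w (elt 0) m q))"
  proof -
    have "(st d w (elt 0) 0 q)(6 := st d w (elt 0) 0 q 2 @ st d w (elt 0) 0 q 6) = st d w (elt 0) m q"
      by (auto simp: st_def fun_eq_iff)
    then show ?thesis using exec_copy[of 2 6 "st d w (elt 0) 0 q" orc] by (simp add: st_def)
  qed
  have 4: "exec orc (8 * m + 2) (prepend 5 10) (st d w (elt a) 0 q) (return_pmf (st d w [] 0 (elt a @ q)))" for a
  proof -
    have "(st d w (elt a) 0 q)(5 := [], 10 := st d w (elt a) 0 q 5 @ st d w (elt a) 0 q 10) = st d w [] 0 (elt a @ q)"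
      by (auto simp: st_def fun_eq_iff)
    then show ?thesis using exec_prepend[of 5 10 "st d w (elt a) 0 q" orc] by (simp add: st_def)
  qed
  have 5: "exec orc ((m + e) * (34 * m + 15) + 1 + (8 * m + 2)) ([While 6 extend_bit] @ prepend 5 10) (st d w (elt 0) (m + e) q)
     (map_pmf (\<lambda>a. st d w [] 0 (elt a @ q)) (random_extension (m + e) 0))"
    unfolding map_pmf_def[of "\<lambda>a. st d w [] 0 (elt a @ q)"]
    by (rule exec_append_bind[OF exec_extend_bits 4])
  show ?thesis
    unfolding sample_point_def
    by (rule exec_append[OF 1 exec_append[OF 2 exec_append[OF 3 exec_append[OF exec_push_replicate 5 refl] refl] refl]])
      (simp add: sample_time_def)
qed

lemma exec_sample_points:
  "exec orc (n * (sample_time e + 1) + 1) [While 0 (sample_point e)] (st d (replicate n True) [] 0 q)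
     (map_pmf (\<lambda>as. st d [] [] 0 (concat (map elt as) @ q)) (iid_list n (random_extension (m + e) 0)))"
proof (induction n arbitrary: q)
  case 0
  have "exec orc (Suc 0) [While 0 (sample_point e)] (st d [] [] 0 q) (return_pmf (st d [] [] 0 q))"
    by (rule exec_While_Nil[OF _ exec_Nil]) (simp add: st_def)
  then show ?case by simp
next
  case (Suc n)
  let ?D = "random_extension (m + e) 0"
  have "exec orc (Suc (sample_time e + (n * (sample_time e + 1) + 1))) [While 0 (sample_point e)]
     (st d (replicate (Suc n) True) [] 0 q)
     (bind_pmf ?D (\<lambda>a. map_pmf (\<lambda>as. st d [] [] 0 (concat (map elt as) @ elt a @ q)) (iid_list n ?D)))"
    unfolding replicate_Suc
    by (rule exec_While_Cons, simp add: st_def, rule exec_append_bind[OF exec_sample_point Suc])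
  moreover have "Suc (sample_time e + (n * (sample_time e + 1) + 1)) = Suc n * (sample_time e + 1) + 1" by simp
  ultimately show ?case
    by (simp only: iid_list_Suc_snoc map_bind_pmf pmf.map_comp o_def map_append concat_append list.map concat.simps append_assoc append_Nil)
qed

definition pit_time :: "nat \<Rightarrow> nat \<Rightarrow> nat" where
  "pit_time e n = n * (sample_time e + 1) + 7 * m + 4"

text \<open>The comparison consumes the encoding of zero, hence the emptied register 3. Closedness
  of the evaluation gives the answer to the query \<open>m\<close> bits, as the comparison
  requires.\<close>

lemma exec_pit:
  assumes "black_box R n f orc" "\<And>xs. set xs \<subseteq> carrier R \<Longrightarrow> length xs = n \<Longrightarrow> mpoly_eval R f xs \<in> carrier R"
  shows "exec orc (pit_time e n) (pit e) (pit_input n d m R)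
     (map_pmf (\<lambda>as. (st d [mpoly_eval R f (map elt as) = \<zero>] [] 0 [])(3 := []))
       (iid_list n (random_extension (m + e) 0)))"
proof -
  have inp: "pit_input n d m R = st d (replicate n True) [] 0 []"
    by (auto simp: pit_input_def st_def fun_eq_iff)
  have "exec orc (7 * m + 3) ([Push 0 True, Call EvalPoly 10] @ [While 10 compare_body])
      (st d [] [] 0 (concat (map elt as) @ []))
      (return_pmf ((st d [mpoly_eval R f (map elt as) = \<zero>] [] 0 [])(3 := [])))"
    if "as \<in> set_pmf (iid_list n (random_extension (m + e) 0))" for as
  proof -
    have len: "length as = n" using length_iid_list[OF that] .
    let ?v = "mpoly_eval R f (map elt as)"
    have v: "?v \<in> carrier R" "orc EvalPoly (concat (map elt as)) = ?v"
      using assms len by (auto simp: black_box_def image_subset_iff)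
    let ?s = "st d [] [] 0 (concat (map elt as) @ [])"
    let ?s' = "?s(0 := True # ?s 0)"
    let ?t = "st d [True] [] 0 ?v"
    have t: "?s'(10 := orc EvalPoly (?s' 10)) = ?t"
      using v by (auto simp: st_def fun_eq_iff)
    have "?t(0 := [True \<and> ?t 10 = ?t 3], 3 := [], 10 := []) = (st d [?v = \<zero>] [] 0 [])(3 := [])"
      by (auto simp: st_def fun_eq_iff)
    with exec_compare[of ?t True orc] have
      "exec orc (7 * m + 1) [While 10 compare_body] ?t (return_pmf ((st d [?v = \<zero>] [] 0 [])(3 := [])))"
      using carrier_length[OF v(1)] by (simp add: st_def)
    then have "exec orc (Suc (Suc (7 * m + 1))) (Push 0 True # Call EvalPoly 10 # [While 10 compare_body]) ?s
      (return_pmf ((st d [?v = \<zero>] [] 0 [])(3 := [])))"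
      by (intro exec_Push exec_Call) (simp only: t)
    moreover have "Suc (Suc (7 * m + 1)) = 7 * m + 3" by simp
    ultimately show ?thesis by (simp only: append.simps)
  qed
  from exec_append_bind[OF exec_sample_points this]
  have "exec orc (n * (sample_time e + 1) + 1 + (7 * m + 3)) (pit e) (st d (replicate n True) [] 0 [])
     (map_pmf (\<lambda>as. (st d [mpoly_eval R f (map elt as) = \<zero>] [] 0 [])(3 := []))
       (iid_list n (random_extension (m + e) 0)))"
    unfolding pit_def map_pmf_def[of "\<lambda>as. (st d [mpoly_eval R f (map elt as) = \<zero>] [] 0 [])(3 := [])"] .
  then show ?thesis by (simp add: inp pit_time_def algebra_simps)
qed

end

section \<open>Running time bound, annihilating integer and error probability\<close>

text \<open>With an empty continuation the machine stops after exactly \<open>t\<close> steps, and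
  finished configurations are stable, so the exact count becomes an upper bound.\<close>

lemma exec_finished:
  assumes "exec orc t P s D" "t \<le> t'"
  shows "run orc t' (P, s) = map_pmf (Pair []) D"
proof -
  have "run orc t' (P, s) = bind_pmf (run orc t (P, s)) (run orc (t' - t))"
    using assms(2) run_add[of orc t "t' - t" "(P, s)"] by simp
  moreover have "run orc t (P, s) = map_pmf (Pair []) D"
    using assms(1) unfolding exec_def by (metis append_Nil2)
  ultimately show ?thesis by (simp add: bind_assoc_pmf bind_return_pmf map_pmf_def)
qed

text \<open>The time is cubic in the input size. The constant 67 is 26 + 34 from sampling plus 7
  from the comparison, and it is reused as a generous exponent so that a single constant serves as
  factor and exponent.\<close>

lemma (in oracle_ring) pit_time_le:
  "pit_time e n \<le> (67 * (e + 1)) * (n + d + m + 1) ^ (67 * (e + 1))"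
proof -
  define N where "N = n + d + m + 1"
  define E where "E = e + 1"
  have N: "n \<le> N" "m \<le> N" "1 \<le> N" and E: "1 \<le> E" by (auto simp: N_def E_def)
  have NE: "N \<le> N * E" "1 \<le> N * E" "E \<le> N * E" using N E by auto
  have me: "m + e \<le> N * E"
  proof -
    have "m + e \<le> N + (E - 1)" using N by (simp add: E_def)
    also have "\<dots> \<le> N + N * (E - 1)" using N by simp
    also have "\<dots> = N * E" using E by (simp add: algebra_simps)
    finally show ?thesis .
  qed
  have "sample_time e + 1 \<le> 26 * (N * E) + (N * E) * (34 * N)"
  proof -
    have "(m + e) * (34 * m + 15) \<le> (N * E) * (34 * N)" using me by (intro mult_mono) (auto simp: N_def)
    moreover have "26 * m + 9 + e \<le> 26 * (N * E)"
    proof -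
      have "26 * m + 9 + e \<le> 25 * N + (m + e)" by (simp add: N_def)
      with me NE show ?thesis by linarith
    qed
    ultimately show ?thesis by (simp add: sample_time_def)
  qed
  also have "\<dots> \<le> 60 * E * N ^ 2"
  proof -
    have "N * E \<le> E * N ^ 2" using N by (simp add: power2_eq_square)
    moreover have "(N * E) * (34 * N) = 34 * (E * N ^ 2)" by (simp add: power2_eq_square)
    ultimately show ?thesis by linarith
  qed
  finally have "n * (sample_time e + 1) \<le> N * (60 * E * N ^ 2)" using N by (intro mult_mono) auto
  also have "\<dots> = 60 * (E * N ^ 3)" by (simp add: power2_eq_square power3_eq_cube)
  finally have 1: "n * (sample_time e + 1) \<le> 60 * (E * N ^ 3)" .
  have "7 * m + 4 \<le> 7 * N" by (simp add: N_def)
  also have "N \<le> E * N ^ 3" using N E by (simp add: power3_eq_cube)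
  finally have "pit_time e n \<le> 67 * E * N ^ 3" using 1 by (simp add: pit_time_def)
  also have "\<dots> \<le> 67 * E * N ^ (67 * E)"
    using N E by (intro mult_left_mono power_increasing) auto
  finally show ?thesis by (simp add: N_def E_def)
qed

lemma (in oracle_ring) finite_carrier: "finite (carrier R)" and card_carrier_le: "card (carrier R) \<le> 2 ^ m"
proof -
  have sub: "carrier R \<subseteq> {xs. set xs \<subseteq> UNIV \<and> length xs = m}" using carrier_length by auto
  have fin: "finite {xs :: bool list. set xs \<subseteq> UNIV \<and> length xs = m}" by (rule finite_lists_length_eq) simp
  show "finite (carrier R)" using sub fin finite_subset by blast
  show "card (carrier R) \<le> 2 ^ m"
    using card_mono[OF fin sub] card_lists_length_eq[of "UNIV :: bool set" m] by simp
qed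

lemma (in cring) mpoly_eval_closed:
  assumes "f \<in> mpolys R n" "set xs \<subseteq> carrier R" "length xs = n"
  shows "mpoly_eval R f xs \<in> carrier R"
proof -
  have "f M \<in> carrier R" for M
    using indexed_pset_in_carrier[of "carrier R" f] assms(1) carrier_coeffE unfolding mpolys_def by blast
  moreover have "xs ! i \<in> carrier R" if "f M \<noteq> \<zero>" "i \<in># M" for M i
  proof -
    have "i < n" using set_mset_subset_indexed_pset that assms(1) unfolding mpolys_def by blast
    then show ?thesis using assms(2,3) nth_mem by blast
  qed
  ultimately show ?thesis unfolding mpoly_eval_def
    by (intro finsum_closed) (auto intro!: m_closed finprod_closed)
qed

text \<open>The product of the local characteristics may exceed the characteristic of the ring, but
  it is a multiple of each of them and has no prime factors besides the \<open>p i\<close>, which is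
  what the choice of the prime requires.\<close>

lemma RDirProd_list_char_annihilator:
  assumes "ring R" "R \<simeq> RDirProd_list Rs"
    and "\<And>i. i < length Rs \<Longrightarrow> local_ring (Rs ! i) \<and> prime (p i) \<and> ring_char (Rs ! i) = p i ^ \<alpha> i"
  defines "N \<equiv> \<Prod>i<length Rs. p i ^ \<alpha> i"
  shows "add_pow R N \<one>\<^bsub>R\<^esub> = \<zero>\<^bsub>R\<^esub>" "N > 0" "\<And>q. prime q \<Longrightarrow> q dvd N \<Longrightarrow> \<exists>i<length Rs. q = p i"
proof -
  have rings: "ring (Rs ! i)" if "i < length Rs" for i
    using assms(3)[OF that] unfolding local_ring_def cring_def by blast
  have "ring S \<and> add_pow S N \<one>\<^bsub>S\<^esub> = \<zero>\<^bsub>S\<^esub>" if "S \<in> set Rs" for S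
  proof -
    obtain i where i: "i < length Rs" "S = Rs ! i" using \<open>S \<in> set Rs\<close> by (metis in_set_conv_nth)
    interpret S: ring S using rings i by simp
    have "S.add.ord \<one>\<^bsub>S\<^esub> dvd N"
      using assms(3)[OF i(1)] i unfolding N_def ring_char_def by (metis dvd_prodI finite_lessThan lessThan_iff)
    then show ?thesis using S.add.pow_eq_id[of "\<one>\<^bsub>S\<^esub>" N] S.ring_axioms by simp
  qed
  then have "add_pow (RDirProd_list Rs) N \<one>\<^bsub>RDirProd_list Rs\<^esub> = \<zero>\<^bsub>RDirProd_list Rs\<^esub>"
    by (rule add_pow_one_RDirProd_list_eq_zero)
  moreover have "ring (RDirProd_list Rs)" using rings by (rule RDirProd_list_is_ring)
  ultimately show "add_pow R N \<one>\<^bsub>R\<^esub> = \<zero>\<^bsub>R\<^esub>"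
    using ring_iso_add_pow_one_eq_zero assms(1,2) by blast
  show "N > 0" unfolding N_def using assms(3) by (auto intro!: prod_pos simp: prime_gt_0_nat)
  show "\<exists>i<length Rs. q = p i" if "prime q" "q dvd N" for q
  proof -
    have "\<exists>i\<in>{..<length Rs}. q dvd p i ^ \<alpha> i"
      using that prime_dvd_prod_iff[of "{..<length Rs}" q "\<lambda>i. p i ^ \<alpha> i"] unfolding N_def by simp
    then obtain i where "i < length Rs" "q dvd p i ^ \<alpha> i" by blast
    then show ?thesis using that(1) assms(3) prime_dvd_power primes_dvd_imp_eq by metis
  qed
qed

theorem theorem9:
  fixes \<epsilon> :: real
  assumes "\<epsilon> > 0"
  shows "\<exists>(P :: program) (c :: nat).
    \<forall>(m :: nat) (n :: nat) (d :: nat) (k :: nat) (R :: bool list ring)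
      (f :: nat multiset \<Rightarrow> bool list) (orc :: oracles)
      (Rs :: bool list ring list) (p :: nat \<Rightarrow> nat) (\<alpha> :: nat \<Rightarrow> nat).
      bit_string_ring m R \<and> ring_oracle R orc \<and>
      R \<simeq> RDirProd_list Rs \<and>
      (\<forall>i < length Rs. local_ring (Rs ! i) \<and> prime (p i) \<and> ring_char (Rs ! i) = p i ^ \<alpha> i) \<and>
      f \<in> mpolys R n \<and> total_degree_le R f d \<and> black_box R n f orc \<and>
      k \<ge> 2 \<and> (\<forall>i < length Rs. p i \<ge> k * n * d)
      \<longrightarrow>
      (let t = c * (n + d + m + 1) ^ c; s = pit_input n d m R in
         halts_within orc t P s \<and>
         answer_prob orc t P s (f = zero_mpoly R) \<ge> 1 - 1 / real k * (1 + \<epsilon> / 2))"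
proof -
  \<comment> \<open>These \<open>e\<close> additional bits make the deviation of the sampled
    integers from uniform residues less than an \<epsilon>/2 fraction of the ideal
    probability.\<close>
  obtain e where e: "(1 / 2) ^ e < \<epsilon> / 2"
    using real_arch_pow_inv[of "\<epsilon> / 2" "1 / 2"] assms by auto
  define c where "c = 67 * (e + 1)"
  show ?thesis
  proof (intro exI[of _ "pit e"] exI[of _ c] allI impI; elim conjE)
    fix m n d k :: nat and R :: "bool list ring" and f :: "nat multiset \<Rightarrow> bool list" and orc :: oracles
      and Rs :: "bool list ring list" and p \<alpha> :: "nat \<Rightarrow> nat"
    assume R: "bit_string_ring m R" "ring_oracle R orc" "R \<simeq> RDirProd_list Rs"
      and Rs: "\<forall>i < length Rs. local_ring (Rs ! i) \<and> prime (p i) \<and> ring_char (Rs ! i) = p i ^ \<alpha> i"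
      and f: "f \<in> mpolys R n" "total_degree_le R f d" "black_box R n f orc"
      and k: "k \<ge> 2" "\<forall>i < length Rs. p i \<ge> k * n * d"
    interpret cring R using R(1) by (simp add: bit_string_ring_def)
    interpret oracle_ring R m orc
      by unfold_locales (use R in \<open>auto simp: bit_string_ring_def\<close>)
    define D where "D = iid_list n (random_extension (m + e) 0)"
    define h where "h = (\<lambda>as. (st d [mpoly_eval R f (map elt as) = \<zero>\<^bsub>R\<^esub>] [] 0 [])(3 := []))"
    let ?t = "c * (n + d + m + 1) ^ c"
    let ?s = "pit_input n d m R"
    have "exec orc (pit_time e n) (pit e) ?s (map_pmf h D)"
      unfolding h_def D_def using f mpoly_eval_closed by (intro exec_pit) auto
    then have run: "run orc ?t (pit e, ?s) = map_pmf (\<lambda>as. ([], h as)) D"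
      using exec_finished pit_time_le[of e n d] by (simp add: pmf.map_comp o_def c_def)
    then have halts: "halts_within orc ?t (pit e) ?s"
      by (auto simp: halts_within_def)
    have ans: "answer_prob orc ?t (pit e) ?s b =
        measure_pmf.prob D {as. (mpoly_eval R f (map elt as) = \<zero>\<^bsub>R\<^esub>) = b}" for b
      unfolding answer_prob_def run by (auto simp: h_def st_def intro!: arg_cong2[of _ _ _ _ measure])
    have "1 - 1 / real k * (1 + \<epsilon> / 2) \<le> answer_prob orc ?t (pit e) ?s (f = zero_mpoly R)"
    proof (cases "f = zero_mpoly R")
      case True
      \<comment> \<open>The error is one-sided: the zero polynomial is recognised with
        certainty.\<close>
      then have "mpoly_eval R f xs = \<zero>\<^bsub>R\<^esub>" for xs
        by (simp add: mpoly_eval_def zero_mpoly_def indexed_zero_def)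
      then show ?thesis using True ans[of True] assms k(1) by simp
    next
      case False
      define N where "N = (\<Prod>i<length Rs. p i ^ \<alpha> i)"
      have N: "add_pow R N \<one>\<^bsub>R\<^esub> = \<zero>\<^bsub>R\<^esub>" "N > 0" "\<And>q. prime q \<Longrightarrow> q dvd N \<Longrightarrow> \<exists>i<length Rs. q = p i"
        using RDirProd_list_char_annihilator[OF ring_axioms R(3), of p \<alpha>] Rs unfolding N_def by blast+
      obtain q where q: "prime q" "q dvd N" "q \<le> card (carrier R)"
        and bound: "\<And>D \<delta>. (\<And>c. measure_pmf.prob D {x. x mod q = c} \<le> \<delta>) \<Longrightarrow>
          measure_pmf.prob (iid_list n D) {as. mpoly_eval R f (map (\<lambda>a. add_pow R a \<one>\<^bsub>R\<^esub>) as) = \<zero>\<^bsub>R\<^esub>}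
            \<le> real n * real d * \<delta>"
        using prob_mpoly_eval_eq_zero_le[OF finite_carrier f(1,2) False N(1,2)] by metis
      have q0: "0 < q" using q(1) prime_gt_0_nat by blast
      \<comment> \<open>The prime is unknown to the program, but encodings have \<open>m\<close>
        bits, so a range of size \<open>2 ^ (m + e)\<close> exceeds it by a factor of at least
        \<open>2 ^ e\<close>.\<close>
      have "q \<le> 2 ^ m" using q(3) card_carrier_le by simp
      then have "real q \<le> 2 ^ m" by (metis of_nat_le_iff of_nat_numeral of_nat_power)
      then have "real q / 2 ^ (m + e) \<le> (1 / 2) ^ e"
        using divide_right_mono[of "real q" "2 ^ m" "2 ^ (m + e)"] by (simp add: power_add power_one_over)
      then have "real q / 2 ^ (m + e) / real q \<le> (\<epsilon> / 2) / real q"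
        using e by (intro divide_right_mono; linarith)
      then have \<delta>: "1 / real q + 1 / 2 ^ (m + e) \<le> (1 + \<epsilon> / 2) / real q"
        using q0 by (simp add: add_divide_distrib)
      \<comment> \<open>The prime \<open>q\<close> divides the annihilator and hence is one of the
        \<open>p i\<close>, to which the size hypothesis applies.\<close>
      have "k * n * d \<le> q" using N(3)[OF q(1,2)] k(2) by auto
      then have "real k * (real n * real d) \<le> real q"
        by (metis mult.assoc of_nat_le_iff of_nat_mult)
      then have nd: "real n * real d / real q \<le> 1 / real k"
        using k(1) q0 by (simp add: field_simps)
      have "measure_pmf.prob D {as. mpoly_eval R f (map elt as) = \<zero>\<^bsub>R\<^esub>}
          \<le> real n * real d * (1 / real q + 1 / 2 ^ (m + e))"
        using bound[OF prob_random_extension_mod_le[OF q0]] unfolding D_def elt_def by blast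
      also have "\<dots> \<le> real n * real d * ((1 + \<epsilon> / 2) / real q)"
        using \<delta> by (intro mult_left_mono) auto
      also have "\<dots> = real n * real d / real q * (1 + \<epsilon> / 2)" by simp
      also have "\<dots> \<le> 1 / real k * (1 + \<epsilon> / 2)"
        using nd assms by (intro mult_right_mono) auto
      finally have "measure_pmf.prob D {as. mpoly_eval R f (map elt as) = \<zero>\<^bsub>R\<^esub>} \<le> 1 / real k * (1 + \<epsilon> / 2)" .
      moreover have "measure_pmf.prob D {as. (mpoly_eval R f (map elt as) = \<zero>\<^bsub>R\<^esub>) = False}
          = 1 - measure_pmf.prob D {as. mpoly_eval R f (map elt as) = \<zero>\<^bsub>R\<^esub>}"
        using measure_pmf.prob_compl[of "{as. mpoly_eval R f (map elt as) = \<zero>\<^bsub>R\<^esub>}" D]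
        by (simp add: Compl_eq_Diff_UNIV[symmetric] Collect_neg_eq)
      ultimately show ?thesis using ans[of False] False by simp
    qed
    with halts show "let t = c * (n + d + m + 1) ^ c; s = pit_input n d m R in
         halts_within orc t (pit e) s \<and>
         answer_prob orc t (pit e) s (f = zero_mpoly R) \<ge> 1 - 1 / real k * (1 + \<epsilon> / 2)"
      by (simp add: Let_def)
  qed
qed

end
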